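(* Let $X$ be a complete, separable metric space admitting a generalized universal covering $p\colon\widetilde X\to X$. Assume that $X$ is semi-locally simply connected at $x_0\in X$ and that the deck group $G\cong\pi_1(X,x_0)$ is uncountable, and let $\tilde x_0\in p^{-1}\{x_0\}$. Then the map $p_1\colon S_1^{G\tilde x_0}(\widetilde X)\to S_1^{x_0}(X)$, $\tilde\sigma\mapsto p\circ\tilde\sigma$, admits no Borel section.
   Context: Generalized universal covering space: for a path-connected space $X$ it is a space $\widetilde X$ with a continuous surjection $p\colon\widetilde X\to X$ such that (i) $\widetilde X$ is locally path-connected and simply connected; (ii) if $Y$ is path-connected and locally path-connected, then every pointed continuous map $f\colon(Y,y)\to(X,x)$ with $f_*(\pi_1(Y,y))=1$ admits unique pointed liftings, i.e. for each $\tilde x\in p^{-1}\{x\}$ there is a unique pointed continuous map $g\colon(Y,y)\to(\widetilde X,\tilde x)$ with $p\circ g=f$. The deck transformation group is isomorphic to $\pi_1(X,x_0)$ and acts freely and transitively on each fibre, so $p^{-1}\{x_0\}=G\tilde x_0$. $X$ is semi-locally simply connected at $x_0$ if some neighbourhood $V$ of $x_0$ has $\mathrm{im}(\pi_1(V,x_0)\to\pi_1(X,x_0))$ trivial. $S_1^{x_0}(X)$ is the set of singular $1$-simplices in $X$ with both vertices mapped to $x_0$; $S_1^{G\tilde x_0}(\widetilde X)$ is the set of singular $1$-simplices in $\widetilde X$ with both vertices mapped into $G\tilde x_0$. Both carry the compact-open topology and its Borel $\sigma$-algebra. A Borel section is a Borel-measurable map $s\colon S_1^{x_0}(X)\to S_1^{G\tilde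 x_0}(\widetilde X)$ with $p_1\circ s=\mathrm{id}$. *)

theory Defs
  imports "HOL-Analysis.Analysis" "HOL-Homology.Homology"
begin

section \<open>Generalized universal coverings\<close>

text \<open>The induced homomorphism on fundamental groups based at \<^term>\<open>y\<close> and
  \<^term>\<open>f y\<close> is trivial.\<close>

definition pi1_trivial :: "'c topology \<Rightarrow> 'c \<Rightarrow> ('c \<Rightarrow> 'a::topological_space) \<Rightarrow> bool" where
  "pi1_trivial Y y f \<longleftrightarrow>
     (\<forall>\<gamma>. pathin Y \<gamma> \<and> \<gamma> 0 = y \<and> \<gamma> 1 = y \<longrightarrow> homotopic_paths UNIV (f \<circ> \<gamma>) (\<lambda>_. f y))"

text \<open>Unique liftings against test spaces \<^term>\<open>Y\<close>. A definition in HOL cannot quantify over all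
  types, so the carriers of the test spaces are subsets of a type \<^typ>\<open>'c\<close>, which is a
  parameter. As a hypothesis the property is weakest for small \<^typ>\<open>'c\<close>; for
  \<^typ>\<open>'b + real\<close> the test spaces include copies of the disc and of the total space. Liftings are required to be extensional because functions agreeing on the
  carrier of \<^term>\<open>Y\<close> represent the same map.\<close>

definition unique_pointed_liftings ::
    "'c itself \<Rightarrow> ('b::topological_space \<Rightarrow> 'a::topological_space) \<Rightarrow> bool" where
  "unique_pointed_liftings _ p \<longleftrightarrow>
     (\<forall>(Y :: 'c topology) y f xt.
        path_connected_space Y \<and> locally_path_connected_space Y \<and> y \<in> topspace Y \<and>
        continuous_map Y euclidean f \<and> pi1_trivial Y y f \<and> p xt = f y \<longrightarrow>
        (\<exists>!g. g \<in> extensional (topspace Y) \<and> continuous_map Y euclidean g \<and> g y = xt \<and>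
              (\<forall>z\<in>topspace Y. p (g z) = f z)))"

definition generalized_universal_covering ::
    "'c itself \<Rightarrow> ('b::topological_space \<Rightarrow> 'a::topological_space) \<Rightarrow> bool" where
  "generalized_universal_covering T p \<longleftrightarrow>
     path_connected (UNIV :: 'a set) \<and> continuous_on UNIV p \<and> surj p \<and>
     locally path_connected (UNIV :: 'b set) \<and> simply_connected (UNIV :: 'b set) \<and>
     unique_pointed_liftings T p"

definition deck_group :: "('b::topological_space \<Rightarrow> 'a) \<Rightarrow> ('b \<Rightarrow> 'b) set" where
  "deck_group p = {h. (\<exists>k. homeomorphism UNIV UNIV h k) \<and> p \<circ> h = p}"

definition semilocally_simply_connected_at :: "'a::topological_space \<Rightarrow> bool" where
  "semilocally_simply_connected_at x \<longleftrightarrow>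
     (\<exists>V. x \<in> interior V \<and> pi1_trivial (top_of_set V) x id)"

section \<open>Spaces of singular simplices\<close>

text \<open>Maps are represented by functions that are extensional on the carrier of the domain, in
  agreement with \<^const>\<open>singular_simplex\<close>. Taking \<^term>\<open>K = {}\<close> shows that the carrier of this
  topology consists of all continuous maps.\<close>

definition compact_open_topology :: "'a topology \<Rightarrow> 'b topology \<Rightarrow> ('a \<Rightarrow> 'b) topology" where
  "compact_open_topology X Y =
     topology_generated_by
       {{f. continuous_map X Y f \<and> f \<in> extensional (topspace X) \<and> f ` K \<subseteq> U} | K U.
          compactin X K \<and> openin Y U}"

definition singular_1_simplices :: "'a::topological_space set \<Rightarrow> ((nat \<Rightarrow> real) \<Rightarrow> 'a) set" where
  "singular_1_simplices A =
     {\<sigma>. singular_simplex 1 euclidean \<sigma> \<and> (\<forall>i\<in>{0, 1}. \<sigma> (\<lambda>j. if j = i then 1 else 0) \<in> A)}"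

definition simplices_topology ::
    "'a::topological_space set \<Rightarrow> ((nat \<Rightarrow> real) \<Rightarrow> 'a) topology" where
  "simplices_topology A =
     subtopology
       (compact_open_topology (subtopology (powertop_real UNIV) (standard_simplex 1)) euclidean)
       (singular_1_simplices A)"

definition borel_of :: "'a topology \<Rightarrow> 'a measure" where
  "borel_of X = sigma (topspace X) {U. openin X U}"

definition borel_section ::
    "('b::topological_space \<Rightarrow> 'a::topological_space) \<Rightarrow> 'a \<Rightarrow> 'b \<Rightarrow>
     (((nat \<Rightarrow> real) \<Rightarrow> 'a) \<Rightarrow> ((nat \<Rightarrow> real) \<Rightarrow> 'b)) \<Rightarrow> bool" where
  "borel_section p x0 xt0 s \<longleftrightarrow>
     s \<in> borel_of (simplices_topology {x0})
           \<rightarrow>\<^sub>M borel_of (simplices_topology ((\<lambda>h. h xt0) ` deck_group p)) \<and>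
     (\<forall>\<sigma>\<in>singular_1_simplices {x0}. simplex_map 1 p (s \<sigma>) = \<sigma>)"

lemma topspace_compact_open_topology:
  "topspace (compact_open_topology X Y) =
     {f. continuous_map X Y f \<and> f \<in> extensional (topspace X)}"
proof -
  have "{f. continuous_map X Y f \<and> f \<in> extensional (topspace X)}
          \<in> {{f. continuous_map X Y f \<and> f \<in> extensional (topspace X) \<and> f ` K \<subseteq> U} | K U.
              compactin X K \<and> openin Y U}"
    by (rule CollectI, rule exI[of _ "{}"], rule exI[of _ "topspace Y"]) auto
  then show ?thesis
    unfolding compact_open_topology_def topology_generated_by_topspace by blast
qed

lemma space_borel_of_simplices_topology:
  "space (borel_of (simplices_topology A)) = singular_1_simplices A"
proof -
  have "topspace (subtopology (powertop_real UNIV) (standard_simplex 1)) = standard_simplex 1"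
    by simp
  then have "topspace (simplices_topology A) = singular_1_simplices A"
    unfolding simplices_topology_def topspace_subtopology topspace_compact_open_topology
    by (auto simp: singular_1_simplices_def singular_simplex_def)
  moreover have "space (borel_of (simplices_topology A)) = topspace (simplices_topology A)"
    unfolding borel_of_def by (rule space_measure_of) (auto dest: openin_subset)
  ultimately show ?thesis by simp
qed

end

theory Submission
  imports Defs
begin

text \<open>
  Let \<open>D\<close> be the orbit of \<open>xt0\<close> and suppose that \<open>s\<close> is a Borel section. Semi-local simple connectedness
  makes the fibre over \<open>x0\<close> discrete, so the map \<open>F\<close> sending a loop \<open>\<sigma>\<close> to the pair of endpoints of
  \<open>s \<sigma>\<close> has the property that the preimage of every subset of \<open>D \<times> D\<close> whatsoever is Borel. On the
  other hand \<open>F\<close> takes uncountably many values: on the projection of a path from \<open>xt0\<close> to \<open>d\<close> it is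
  \<open>(h xt0, h d)\<close> for some deck transformation \<open>h\<close>, and this pair determines \<open>h\<close> and hence \<open>d\<close>.

  The space of loops is a continuous image of a closed subset of a Polish space. So it suffices that
  a map on a Polish space all of whose preimages are Borel has countable range. If the range were
  uncountable, a Cantor scheme, built after refining the topology to make the preimages of countably
  many sets separating the values clopen, would give an injection of \<open>[0, 1)\<close> along which every subset
  of \<open>[0, 1)\<close> becomes Borel, and a Vitali set is not.
\<close>

section \<open>Maps all of whose preimages are Borel\<close>

text \<open>Choose one representative in [0, 1) from each coset of the rationals. The translates by
  the countably many rationals in [-1, 1] are disjoint, cover [0, 1) and stay inside [-1, 2], which
  contradicts countable additivity.\<close>

lemma exists_non_borel_subset:
  obtains S :: "real set" where "S \<subseteq> {0..<1}" "S \<notin> sets borel"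
proof -
  define r where "r x = (SOME y. y \<in> {0..<1} \<and> x - y \<in> \<rat>)" for x :: real
  have r: "r x \<in> {0..<1} \<and> x - r x \<in> \<rat>" for x
    unfolding r_def
  proof (rule someI_ex)
    show "\<exists>y. y \<in> {0..<1} \<and> x - y \<in> \<rat>"
      by (rule exI[of _ "frac x"]) (use frac_lt_1[of x] frac_ge_0[of x] in \<open>auto simp: frac_def\<close>)
  qed
  \<comment> \<open>For \<open>x\<close> and \<open>y\<close> in the same coset the predicates under
    \<open>SOME\<close> are equal, so the same representative is chosen.\<close>
  have req: "r x = r y" if "x - y \<in> \<rat>" for x y
  proof -
    have "x - z \<in> \<rat> \<longleftrightarrow> y - z \<in> \<rat>" for z
      using Rats_diff[of "x - z" "x - y"] Rats_add[of "y - z" "x - y"] that by auto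
    then show ?thesis unfolding r_def by simp
  qed
  define S where "S = range r"
  have S01: "S \<subseteq> {0..<1}" using r unfolding S_def by auto
  have "S \<notin> sets borel"
  proof
    assume SB: "S \<in> sets borel"
    define J where "J = \<rat> \<inter> {-1..1::real}"
    define T where "T q = (\<lambda>x. x - q) -` S" for q
    have TB: "T q \<in> sets lborel" for q
      using measurable_sets_borel[OF _ SB, of "\<lambda>x. x - q"] by (simp add: T_def)
    have emT: "emeasure lborel (T q) = emeasure lborel S" for q
    proof -
      have "emeasure lborel S = emeasure (distr lborel borel ((+) (-q))) S"
        by (simp add: lborel_distr_plus)
      also have "\<dots> = emeasure lborel (T q)"
        using SB by (subst emeasure_distr) (auto simp: T_def vimage_def)
      finally show ?thesis by simp
    qed
    have J: "countable J" "infinite J" "J \<noteq> {}"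
    proof -
      show "countable J" by (simp add: J_def countable_rat)
      have "inj (\<lambda>n. 1 / (real n + 1))" by (auto simp: inj_def)
      moreover have "range (\<lambda>n. 1 / (real n + 1)) \<subseteq> J"
      proof (rule image_subsetI)
        fix n :: nat
        have "0 \<le> 1 / (real n + 1)" "1 / (real n + 1) \<le> 1" by auto
        moreover have "1 / (real n + 1) \<in> \<rat>" by simp
        ultimately show "1 / (real n + 1) \<in> J" unfolding J_def by (simp add: order_trans[of "-1" 0])
      qed
      ultimately show "infinite J" by (meson finite_imageD finite_subset infinite_UNIV_nat)
      then show "J \<noteq> {}" by auto
    qed
    obtain e :: "nat \<Rightarrow> real" where e: "bij_betw e UNIV J"
      using J bij_betw_from_nat_into by blast
    have disj: "disjoint_family (\<lambda>n. T (e n))"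
    proof (unfold disjoint_family_on_def, intro ballI impI)
      fix m n :: nat assume "m \<noteq> n"
      then have ne: "e m \<noteq> e n" using e by (auto simp: bij_betw_def inj_def)
      have eR: "e k \<in> \<rat>" for k using e by (auto simp: bij_betw_def J_def)
      show "T (e m) \<inter> T (e n) = {}"
      proof (rule ccontr)
        assume "T (e m) \<inter> T (e n) \<noteq> {}"
        then obtain x u v where x: "x - e m = r u" "x - e n = r v"
          by (auto simp: T_def S_def)
        have rr: "r (r w) = r w" for w using req[of w "r w"] r[of w] by simp
        have "r u - r v = e n - e m" using x by simp
        then have "r u - r v \<in> \<rat>" using eR by auto
        then have "r u = r v" using req[of "r u" "r v"] rr by simp
        then show False using x ne by simp
      qed
    qed
    have sum: "suminf (\<lambda>n. emeasure lborel (T (e n))) = emeasure lborel (\<Union>n. T (e n))"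
      using TB disj by (intro suminf_emeasure) auto
    have "(\<Union>n. T (e n)) \<subseteq> {-1..2}"
    proof -
      have "T (e n) \<subseteq> {-1..2}" for n
      proof
        fix x assume "x \<in> T (e n)"
        then have "x - e n \<in> {0..<1}" using S01 by (auto simp: T_def)
        moreover have "e n \<in> {-1..1}" using e by (auto simp: bij_betw_def J_def)
        ultimately show "x \<in> {-1..2}" by auto
      qed
      then show ?thesis by auto
    qed
    then have le: "emeasure lborel (\<Union>n. T (e n)) \<le> 3"
      using emeasure_mono[of "\<Union>n. T (e n)" "{-1..2}" lborel] by simp
    have "{0..<1} \<subseteq> (\<Union>n. T (e n))"
    proof
      fix x :: real assume x: "x \<in> {0..<1}"
      have "x - r x \<in> J" using r[of x] x by (auto simp: J_def)
      then obtain n where "e n = x - r x" using e by (metis bij_betw_imp_surj_on imageE)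
      then have "x - e n = r x" by simp
      then show "x \<in> (\<Union>n. T (e n))" by (auto simp: T_def S_def)
    qed
    then have ge: "1 \<le> emeasure lborel (\<Union>n. T (e n))"
      using emeasure_mono[of "{0..<1::real}" "\<Union>n. T (e n)" lborel] TB by auto
    show False
    \<comment> \<open>A sum of infinitely many equal terms is 0 or infinite, whereas this one should
      lie between 1 and 3.\<close>
    proof (cases "emeasure lborel S = 0")
      case True
      then show False using sum ge emT by simp
    next
      case False
      have "emeasure lborel S \<le> 1"
        using emeasure_mono[OF S01, of lborel] by simp
      then obtain m where m: "emeasure lborel S = ennreal m" "0 \<le> m"
        by (cases "emeasure lborel S") (auto simp: top_unique)
      then have "\<not> summable (\<lambda>_::nat. m)" using False by (auto simp: summable_const_iff)
      then have "suminf (\<lambda>n::nat. emeasure lborel S) = Orderings.top"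
        unfolding m(1) using m(2) by (intro summable_iff_suminf_neq_top) auto
      then show False using sum le emT by (simp add: top_unique)
    qed
  qed
  then show ?thesis using that S01 by blast
qed

section \<open>Closed lifts in which Borel sets become clopen\<close>

lemma continuous_on_snd_apply:
  "continuous_on A (\<lambda>w :: 'a::topological_space \<times> ('i \<Rightarrow> 'b::topological_space). snd w i)"
  by (rule continuous_on_product_then_coordinatewise[OF continuous_on_snd[OF continuous_on_id]])

text \<open>A closed set \<open>Q\<close> projecting onto the whole space plays the role of a finer Polish topology, in which
  \<open>B\<close> is clopen.\<close>

definition clopen_lift :: "('w::topological_space \<times> (nat \<Rightarrow> real)) set \<Rightarrow> 'w set \<Rightarrow> bool" where
  "clopen_lift Q B \<longleftrightarrow> closed (Q \<inter> B \<times> UNIV) \<and> closed (Q \<inter> (-B) \<times> UNIV)"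

lemma clopen_lift_Compl: "clopen_lift Q (- B) \<longleftrightarrow> clopen_lift Q B"
  by (auto simp: clopen_lift_def)

text \<open>A countable fibred product of the given lifts over the base: \<open>prod_encode\<close>
  packs countably many sequences into one and \<open>c i\<close> extracts the one with index
  \<open>i\<close>, so a point of \<open>Q\<close> carries a point of every
  \<open>R i\<close>.\<close>

lemma countable_clopen_lift:
  fixes B :: "nat \<Rightarrow> 'w::topological_space set"
  assumes "\<And>i. \<exists>Q. closed Q \<and> fst ` Q = UNIV \<and> clopen_lift Q (B i)"
  obtains Q where "closed Q" "fst ` Q = UNIV" "\<And>i. clopen_lift Q (B i)"
proof -
  obtain R where R: "\<And>i. closed (R i)" "\<And>i. fst ` R i = UNIV" "\<And>i. clopen_lift (R i) (B i)"
    using assms by metis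
  define c where "c i w = (fst w, \<lambda>k. snd w (prod_encode (i, k)))" for i and w :: "'w \<times> (nat \<Rightarrow> real)"
  have cont: "continuous_on UNIV (c i)" for i
    unfolding c_def
    by (intro continuous_intros continuous_on_coordinatewise_then_product continuous_on_snd_apply)
  define Q where "Q = (\<Inter>i. c i -` R i)"
  have cl: "closed (c i -` D)" if "closed D" for i D
    using closed_vimage[OF that cont] .
  show ?thesis
  proof
    show "closed Q" unfolding Q_def using R(1) cl by blast
    show "fst ` Q = UNIV"
    proof -
      have "z \<in> fst ` Q" for z
      proof -
        have "\<exists>y. (z, y) \<in> R i" for i
        proof -
          have "z \<in> fst ` R i" using R(2) by simp
          then show ?thesis by auto
        qed
        then obtain y where y: "\<And>i. (z, y i) \<in> R i" by metis
        have "(z, \<lambda>n. y (fst (prod_decode n)) (snd (prod_decode n))) \<in> Q"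
          using y by (auto simp: Q_def c_def)
        then show ?thesis by force
      qed
      then show ?thesis by auto
    qed
    show "clopen_lift Q (B i)" for i
    proof -
      have "Q \<inter> B i \<times> UNIV = Q \<inter> c i -` (R i \<inter> B i \<times> UNIV)"
        "Q \<inter> (- B i) \<times> UNIV = Q \<inter> c i -` (R i \<inter> (- B i) \<times> UNIV)"
        by (auto simp: Q_def c_def)
      moreover have "closed (Q \<inter> c i -` (R i \<inter> B i \<times> UNIV))"
        "closed (Q \<inter> c i -` (R i \<inter> (- B i) \<times> UNIV))"
        using R(3)[of i] \<open>closed Q\<close> by (auto simp: clopen_lift_def simp del: vimage_Int intro: closed_Int cl)
      ultimately show ?thesis unfolding clopen_lift_def by simp
    qed
  qed
qed

text \<open>A form of the classical fact that a Borel set becomes clopen in some finer Polish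
  topology. In the induction over the sigma-algebra, complements are settled by the symmetry of
  \<open>clopen_lift\<close>; open sets and countable unions need a construction.\<close>

lemma borel_clopen_lift:
  fixes B :: "'w::metric_space set"
  assumes "B \<in> sets borel"
  shows "\<exists>Q. closed Q \<and> fst ` Q = UNIV \<and> clopen_lift Q B"
proof -
  have "B \<in> sigma_sets UNIV {S. open S}" using assms by (simp add: borel_def)
  then show ?thesis
  proof induction
    case (Basic U)
    then have U: "open U" by simp
    show ?case
    proof (cases "U = UNIV")
      case True
      then show ?thesis by (intro exI[of _ UNIV]) (auto simp: clopen_lift_def)
    next
      case False
      \<comment> \<open>Over \<open>U\<close> the coordinate 0 is the reciprocal of the distance to
        the complement. It tends to infinity at the boundary, so \<open>R\<close> is closed even if
        \<open>U\<close> is not.\<close>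
      define P where "P = {w :: 'w \<times> (nat \<Rightarrow> real). fst w \<in> - U \<and> snd w 0 = 0}"
      define R where "R = {w :: 'w \<times> (nat \<Rightarrow> real). snd w 0 * infdist (fst w) (- U) = 1}"
      have zero: "infdist z (- U) = 0 \<longleftrightarrow> z \<notin> U" for z
        using in_closed_iff_infdist_zero[of "- U" z] U False by (auto simp: closed_Compl)
      have snd0: "continuous_on UNIV (\<lambda>w :: 'w \<times> (nat \<Rightarrow> real). snd w 0)"
        by (rule continuous_on_snd_apply)
      have "closed (fst -` (- U) :: ('w \<times> (nat \<Rightarrow> real)) set)"
        using U by (intro closed_vimage continuous_intros) (simp add: closed_Compl)
      moreover have "closed {w :: 'w \<times> (nat \<Rightarrow> real). snd w 0 = 0}"
        by (intro closed_Collect_eq continuous_on_const snd0)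
      moreover have "P = fst -` (- U) \<inter> {w. snd w 0 = 0}"
        by (auto simp: P_def)
      ultimately have "closed P" by (simp add: closed_Int)
      moreover have "closed R" unfolding R_def
        by (intro closed_Collect_eq continuous_on_mult snd0 continuous_on_infdist continuous_on_fst
            continuous_on_id continuous_on_const)
      moreover have "(P \<union> R) \<inter> U \<times> UNIV = R" "(P \<union> R) \<inter> (- U) \<times> UNIV = P"
      proof -
        have "P \<subseteq> (- U) \<times> UNIV" by (auto simp: P_def)
        moreover have "R \<subseteq> U \<times> UNIV" unfolding R_def by clarsimp (metis mult_zero_right zero zero_neq_one)
        ultimately show "(P \<union> R) \<inter> U \<times> UNIV = R" "(P \<union> R) \<inter> (- U) \<times> UNIV = P" by blast+
      qed
      moreover have "z \<in> fst ` (P \<union> R)" for z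
      proof (cases "z \<in> U")
        case True
        then have "(z, \<lambda>_. 1 / infdist z (- U)) \<in> R" using zero[of z] by (simp add: R_def)
        then show ?thesis by force
      next
        case False
        then have "(z, \<lambda>_. 0) \<in> P" by (simp add: P_def)
        then show ?thesis by force
      qed
      ultimately show ?thesis
        by (intro exI[of _ "P \<union> R"]) (auto simp: clopen_lift_def)
    qed
  next
    case Empty
    then show ?case by (intro exI[of _ UNIV]) (auto simp: clopen_lift_def)
  next
    case (Compl a)
    from Compl.IH show ?case unfolding Compl_eq_Diff_UNIV[symmetric] clopen_lift_Compl .
  next
    case (Union a)
    obtain R where R: "closed R" "fst ` R = UNIV" "\<And>i. clopen_lift R (a i)"
      using countable_clopen_lift[of a, OF Union.IH] by metis
    define t where "t w = (fst w, \<lambda>k. snd w (Suc k))" for w :: "'w \<times> (nat \<Rightarrow> real)"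
    define c where "c w = snd w 0" for w :: "'w \<times> (nat \<Rightarrow> real)"
    have tcont: "continuous_on UNIV t"
      unfolding t_def
      by (intro continuous_intros continuous_on_coordinatewise_then_product continuous_on_snd_apply)
    have ccont: "continuous_on UNIV c" unfolding c_def
      by (rule continuous_on_snd_apply)
    \<comment> \<open>The coordinate \<open>c\<close> is \<open>0\<close> outside the union and \<open>k + 1\<close> for a chosen \<open>k\<close> with
      \<open>fst w \<in> a k\<close>; the conditions are phrased with \<open>1 \<le> \<bar>c - _\<bar>\<close> to make them closed.\<close>
    define Q where "Q = t -` R \<inter> c -` \<nat> \<inter>
      ({w. 1 \<le> \<bar>c w - 0\<bar>} \<union> (\<Inter>i. t -` (R \<inter> (- a i) \<times> UNIV))) \<inter>
      (\<Inter>k. {w. 1 \<le> \<bar>c w - (real k + 1)\<bar>} \<union> t -` (R \<inter> a k \<times> UNIV))"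
    have tcl: "closed (t -` D)" if "closed D" for D
      using closed_vimage[OF that tcont] .
    have le: "closed {w. 1 \<le> \<bar>c w - r\<bar>}" for r
      by (intro closed_Collect_le continuous_on_const continuous_on_rabs continuous_on_diff ccont)
    have piece: "closed (t -` (R \<inter> a k \<times> UNIV))" "closed (t -` (R \<inter> (- a k) \<times> UNIV))" for k
      using tcl R(3)[of k] unfolding clopen_lift_def by blast+
    have Qcl: "closed Q" unfolding Q_def
      by (intro closed_Int closed_INT closed_Un ballI le piece tcl R(1) closed_vimage[OF closed_Nats ccont])
    have in_U: "1 \<le> c w" if "w \<in> Q" "fst w \<in> (\<Union>i. a i)" for w
    proof -
      have "c w \<in> \<nat>" using that(1) by (simp add: Q_def)
      then obtain n where n: "c w = real n" by (rule Nats_cases)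
      have "1 \<le> \<bar>c w\<bar>" using that unfolding Q_def by (auto simp: t_def)
      then show ?thesis using n by simp
    qed
    have notin_U: "c w \<le> 0" if "w \<in> Q" "fst w \<notin> (\<Union>i. a i)" for w
    proof (rule ccontr)
      assume *: "\<not> c w \<le> 0"
      have "c w \<in> \<nat>" using that(1) by (simp add: Q_def)
      then obtain n where n: "c w = real n" by (rule Nats_cases)
      then obtain k where k: "n = Suc k" using * by (cases n) auto
      have "w \<in> {w. 1 \<le> \<bar>c w - (real k + 1)\<bar>} \<union> t -` (R \<inter> a k \<times> UNIV)"
        using that(1) unfolding Q_def by blast
      then show False using n k that(2) by (auto simp: t_def)
    qed
    \<comment> \<open>The tag \<open>c\<close> takes natural values on \<open>Q\<close>, so the two
      closed conditions \<open>1 \<le> c w\<close> and \<open>c w \<le> 0\<close> exhaust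
      \<open>Q\<close> and decide membership in the union.\<close>
    have "Q \<inter> (\<Union>i. a i) \<times> UNIV = Q \<inter> {w. 1 \<le> c w}"
      "Q \<inter> (- (\<Union>i. a i)) \<times> UNIV = Q \<inter> {w. c w \<le> 0}"
      using in_U notin_U by (fastforce simp: mem_Times_iff)+
    moreover have "closed {w. 1 \<le> c w}" "closed {w. c w \<le> 0}"
      by (intro closed_Collect_le continuous_on_const ccont)+
    ultimately have "clopen_lift Q (\<Union>i. a i)"
      using Qcl by (auto simp: clopen_lift_def)
    moreover have "z \<in> fst ` Q" for z
    proof -
      have "z \<in> fst ` R" using R(2) by simp
      then obtain y where y: "(z, y) \<in> R" by auto
      show ?thesis
      proof (cases "z \<in> (\<Union>i. a i)")
        case True
        then obtain k where k: "z \<in> a k" by auto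
        \<comment> \<open>The tag is put in front of the sequence \<open>y\<close>; the shift by one
          keeps the index 0 apart from the tag 0, which stands for the complement.\<close>
        have "(z, case_nat (real k + 1) y) \<in> Q"
        proof -
          have "t (z, case_nat (real k + 1) y) = (z, y)" "c (z, case_nat (real k + 1) y) = real (Suc k)"
            by (auto simp: t_def c_def)
          moreover have "1 \<le> \<bar>real (Suc k) - (real j + 1)\<bar>" if "j \<noteq> k" for j
            using that by (cases "j < k") auto
          ultimately show ?thesis using y k unfolding Q_def by auto metis
        qed
        then show ?thesis by force
      next
        case False
        have "(z, case_nat 0 y) \<in> Q"
          using y False by (auto simp: Q_def c_def t_def)
        then show ?thesis by force
      qed
    qed
    ultimately show ?case using Qcl by blast
  qed
qed

section \<open>Cantor schemes\<close>

text \<open>Remove the basic open sets that contribute only countably many values of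
  \<open>G\<close>. There are countably many of them, so the rest of \<open>A\<close> still has
  uncountable image, and each of its points is a condensation point.\<close>

lemma uncountable_image_condensation_points:
  fixes A :: "'w::second_countable_topology set" and G :: "'w \<Rightarrow> 'b"
  assumes "uncountable (G ` A)"
  obtains x y where "x \<in> A" "y \<in> A" "G x \<noteq> G y"
    "\<And>U. open U \<Longrightarrow> x \<in> U \<Longrightarrow> uncountable (G ` (A \<inter> U))"
    "\<And>U. open U \<Longrightarrow> y \<in> U \<Longrightarrow> uncountable (G ` (A \<inter> U))"
proof -
  obtain \<B> :: "'w set set" where \<B>: "countable \<B>" "topological_basis \<B>"
    using ex_countable_basis by blast
  define N where "N = \<Union>{V \<in> \<B>. countable (G ` (A \<inter> V))}"
  have "G ` (A \<inter> N) = (\<Union>V\<in>{V \<in> \<B>. countable (G ` (A \<inter> V))}. G ` (A \<inter> V))"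
    unfolding N_def by blast
  then have "countable (G ` (A \<inter> N))" using \<B>(1)
    by (auto intro!: countable_UN intro: countable_Collect)
  moreover have "G ` A = G ` (A \<inter> N) \<union> G ` (A - N)" by blast
  ultimately have unc: "uncountable (G ` (A - N))" using assms by auto
  have nonempty: "\<exists>a. a \<in> B" if "uncountable B" for B :: "'b set"
    using that by (metis countable_empty ex_in_conv)
  obtain a where a: "a \<in> G ` (A - N)" using nonempty[OF unc] by (rule exE)
  have "uncountable (G ` (A - N) - {a})" using unc by (simp add: uncountable_minus_countable)
  then obtain b where b: "b \<in> G ` (A - N)" "b \<noteq> a" using nonempty[of "G ` (A - N) - {a}"] by blast
  have *: "uncountable (G ` (A \<inter> U))" if z: "z \<in> A - N" "open U" "z \<in> U" for z U
  proof
    assume c: "countable (G ` (A \<inter> U))"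
    obtain V where V: "V \<in> \<B>" "z \<in> V" "V \<subseteq> U"
      using topological_basisE[OF \<B>(2) z(2,3)] by metis
    have "countable (G ` (A \<inter> V))" using V(3) by (intro countable_subset[OF _ c]) auto
    then show False using V z(1) by (auto simp: N_def)
  qed
  from a b obtain x y where "x \<in> A - N" "y \<in> A - N" "G x = a" "G y = b" by auto
  then show ?thesis using b(2) by (intro that[of x y] *) auto
qed

text \<open>A Cantor scheme of closed sets with uncountable \<open>G\<close>-images, siblings having
  disjoint \<open>G\<close>-images. The hypothesis \<open>sep\<close> stands in for continuity of
  \<open>G\<close> on \<open>Q\<close> into a Hausdorff space, as the target has no topology. Nodes
  are indexed by half-open dyadic intervals, so that branches are given by real numbers.\<close>

lemma uncountable_image_borel_transversal:
  fixes G :: "'w::{complete_space,second_countable_topology} \<Rightarrow> 'd"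
  assumes "closed Q" "uncountable (G ` Q)"
    and sep: "\<And>x y. x \<in> Q \<Longrightarrow> y \<in> Q \<Longrightarrow> G x \<noteq> G y \<Longrightarrow>
      \<exists>U V. open U \<and> open V \<and> x \<in> U \<and> y \<in> V \<and> G ` (Q \<inter> U) \<inter> G ` (Q \<inter> V) = {}"
  obtains \<psi> :: "real \<Rightarrow> 'w" where "\<psi> \<in> borel_measurable borel" "range \<psi> \<subseteq> Q" "inj_on (G \<circ> \<psi>) {0..<1}"
proof -
  define big where "big A \<longleftrightarrow> closed A \<and> A \<subseteq> Q \<and> uncountable (G ` A)" for A
  have "\<exists>L R. big A \<longrightarrow> big L \<and> big R \<and> L \<subseteq> A \<and> R \<subseteq> A \<and> G ` L \<inter> G ` R = {} \<and>
      (\<forall>u\<in>L. \<forall>v\<in>L. dist u v \<le> 1 / 2 ^ n) \<and> (\<forall>u\<in>R. \<forall>v\<in>R. dist u v \<le> 1 / 2 ^ n)" for A and n :: nat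
  proof (cases "big A")
    case True
    then obtain x y where xy: "x \<in> A" "y \<in> A" "G x \<noteq> G y"
      and ux: "\<And>U. open U \<Longrightarrow> x \<in> U \<Longrightarrow> uncountable (G ` (A \<inter> U))"
      and uy: "\<And>U. open U \<Longrightarrow> y \<in> U \<Longrightarrow> uncountable (G ` (A \<inter> U))"
      using uncountable_image_condensation_points[of G A] unfolding big_def by metis
    obtain U V where UV: "open U" "open V" "x \<in> U" "y \<in> V" "G ` (Q \<inter> U) \<inter> G ` (Q \<inter> V) = {}"
      using sep[of x y] xy True unfolding big_def by blast
    obtain d1 where d1: "d1 > 0" "cball x d1 \<subseteq> U" using UV open_contains_cball by blast
    obtain d2 where d2: "d2 > 0" "cball y d2 \<subseteq> V" using UV open_contains_cball by blast
    \<comment> \<open>The balls must lie in the separating sets, and their radius is at most half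
      the diameter allowed at level \<open>n\<close>. Closed balls keep the children closed.\<close>
    define d where "d = min (min d1 d2) (1 / 2 ^ Suc n)"
    have d: "d > 0" "d \<le> d1" "d \<le> d2" "d \<le> 1 / 2 ^ Suc n" using d1 d2 by (auto simp: d_def)
    define L where "L = A \<inter> cball x d"
    define R where "R = A \<inter> cball y d"
    have "uncountable (G ` L)"
      using ux[of "ball x d"] d(1) countable_subset[of "G ` (A \<inter> ball x d)" "G ` L"] ball_subset_cball
      by (fastforce simp: L_def)
    moreover have "uncountable (G ` R)"
      using uy[of "ball y d"] d(1) countable_subset[of "G ` (A \<inter> ball y d)" "G ` R"] ball_subset_cball
      by (fastforce simp: R_def)
    ultimately have bigLR: "big L" "big R" using True by (auto simp: big_def L_def R_def)
    have "L \<subseteq> Q \<inter> U" "R \<subseteq> Q \<inter> V"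
      using True d d1 d2 by (auto simp: L_def R_def big_def)
    then have disj: "G ` L \<inter> G ` R = {}" using UV(5) by blast
    have dz: "dist u v \<le> 1 / 2 ^ n" if "dist z u \<le> d" "dist z v \<le> d" for u v z :: 'w
      using dist_triangle2[of u v z] that d(4) by (simp add: dist_commute)
    have diam: "\<forall>u\<in>L. \<forall>v\<in>L. dist u v \<le> 1 / 2 ^ n" "\<forall>u\<in>R. \<forall>v\<in>R. dist u v \<le> 1 / 2 ^ n"
      using dz[of x] dz[of y] by (simp_all add: L_def R_def)
    have "L \<subseteq> A" "R \<subseteq> A" by (auto simp: L_def R_def)
    with bigLR disj diam show ?thesis by blast
  qed auto
  then obtain L R where LR: "\<And>A n. big A \<Longrightarrow> big (L A n) \<and> big (R A n) \<and> L A n \<subseteq> A \<and> R A n \<subseteq> A \<and>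
      G ` L A n \<inter> G ` R A n = {} \<and> (\<forall>u\<in>L A n. \<forall>v\<in>L A n. dist u v \<le> 1 / 2 ^ n) \<and>
      (\<forall>u\<in>R A n. \<forall>v\<in>R A n. dist u v \<le> 1 / 2 ^ n)"
    by metis
  \<comment> \<open>The nodes of level \<open>n\<close> of the binary tree are numbered so that \<open>\<lfloor>2 ^ n * x\<rfloor>\<close> is the node passed
    by the branch of \<open>x\<close>.\<close>
  define N where "N = rec_nat (\<lambda>k :: int. Q)
    (\<lambda>n B k. if even k then L (B (k div 2)) n else R (B (k div 2)) n)"
  have N0: "N 0 k = Q" for k :: int by (simp add: N_def)
  have NS: "N (Suc n) k = (if even k then L (N n (k div 2)) n else R (N n (k div 2)) n)" for n and k :: int
    by (simp add: N_def)
  have bigN: "big (N n k)" for n k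
  proof (induction n arbitrary: k)
    case 0
    then show ?case using assms(1,2) by (simp add: N0 big_def)
  next
    case (Suc n)
    then show ?case using LR by (simp add: NS)
  qed
  have NS_sub: "N (Suc n) k \<subseteq> N n (k div 2)" for n k
    using LR[OF bigN, of n "k div 2" n] by (auto simp: NS)
  have NS_dist: "dist u v \<le> 1 / 2 ^ n" if "u \<in> N (Suc n) k" "v \<in> N (Suc n) k" for u v n k
    using LR[OF bigN, of n "k div 2" n] that by (auto simp: NS split: if_splits)
  \<comment> \<open>Dropping the last binary digit leads to the parent node.\<close>
  have fl: "\<lfloor>2 ^ Suc n * x\<rfloor> div 2 = \<lfloor>2 ^ n * x\<rfloor>" for n and x :: real
    using floor_divide_real_eq_div[of 2 "2 ^ Suc n * x"] by simp
  define c where "c x n = N n \<lfloor>2 ^ n * x\<rfloor>" for x :: real and n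
  have c_Suc: "c x (Suc n) \<subseteq> c x n" for x n
    using NS_sub[of n "\<lfloor>2 ^ Suc n * x\<rfloor>"] by (simp add: c_def fl del: power_Suc)
  have c_ne: "c x n \<noteq> {}" and c_cl: "closed (c x n)" for x n
    using bigN[of n "\<lfloor>2 ^ n * x\<rfloor>"] by (auto simp: c_def big_def)
  have c_dist: "dist u v \<le> 1 / 2 ^ n" if "u \<in> c x (Suc n)" "v \<in> c x (Suc n)" for u v x n
    using NS_dist that by (simp add: c_def del: power_Suc)
  have "\<exists>a. \<forall>n. a \<in> c x n" for x
  proof -
    have "\<exists>a. \<forall>n. a \<in> c x n"
    proof (rule decreasing_closed_nest)
      show "c x n \<subseteq> c x m" if "m \<le> n" for m n
        using that by (rule lift_Suc_antimono_le[of "c x", OF c_Suc])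
      show "\<exists>n. \<forall>u\<in>c x n. \<forall>v\<in>c x n. dist u v < e" if e: "e > 0" for e
      proof -
        obtain n where "(1 / 2) ^ n < e" using real_arch_pow_inv[OF e, of "1/2"] by auto
        then show ?thesis using c_dist by (intro exI[of _ "Suc n"]) (force simp: power_one_over)
      qed
    qed (use c_cl c_ne in auto)
    then show ?thesis .
  qed
  then obtain \<psi> where \<psi>: "\<And>x n. \<psi> x \<in> c x n" by metis
  \<comment> \<open>A point chosen in each node gives functions of a floor, which are Borel; they
    converge to \<open>\<psi>\<close> because the diameters shrink to 0.\<close>
  define pick where "pick n k = (SOME w. w \<in> N n k)" for n and k :: int
  have pick: "pick n \<lfloor>2 ^ n * x\<rfloor> \<in> c x n" for n x
    using c_ne[of x n] by (auto simp: pick_def c_def some_in_eq)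
  show ?thesis
  proof
    show "\<psi> \<in> borel_measurable borel"
    proof (rule borel_measurable_LIMSEQ_metric)
      show "(\<lambda>x::real. pick n \<lfloor>2 ^ n * x\<rfloor>) \<in> borel_measurable borel" for n
      proof -
        have "(\<lambda>x::real. \<lfloor>2 ^ n * x\<rfloor>) \<in> borel \<rightarrow>\<^sub>M count_space UNIV" by measurable
        then show ?thesis by (rule measurable_compose) simp
      qed
      show "(\<lambda>n. pick n \<lfloor>2 ^ n * x\<rfloor>) \<longlonglongrightarrow> \<psi> x" for x :: real
      proof (rule LIMSEQ_imp_Suc, rule iffD2[OF tendsto_dist_iff], rule tendsto_sandwich[OF _ _ tendsto_const])
        show "\<forall>\<^sub>F n in sequentially. dist (pick (Suc n) \<lfloor>2 ^ Suc n * x\<rfloor>) (\<psi> x) \<le> (1 / 2) ^ n"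
          using c_dist[OF pick \<psi>] by (simp add: power_one_over del: power_Suc)
        show "(\<lambda>n. (1 / 2 :: real) ^ n) \<longlonglongrightarrow> 0" by (rule LIMSEQ_realpow_zero) auto
      qed simp
    qed
    show "range \<psi> \<subseteq> Q" using \<psi>[of _ 0] by (auto simp: c_def N0)
    show "inj_on (G \<circ> \<psi>) {0..<1}"
    proof (rule inj_onI)
      fix x y :: real assume x: "x \<in> {0..<1}" and y: "y \<in> {0..<1}" and eq: "(G \<circ> \<psi>) x = (G \<circ> \<psi>) y"
      \<comment> \<open>Where two branches first part they pass through siblings, whose disjoint
        \<open>G\<close>-images contradict \<open>eq\<close>.\<close>
      have same: "\<lfloor>2 ^ n * x\<rfloor> = \<lfloor>2 ^ n * y\<rfloor>" for n
      proof (induction n)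
        case 0
        have "\<lfloor>x\<rfloor> = 0" "\<lfloor>y\<rfloor> = 0" using x y by (auto simp: floor_eq_iff)
        then show ?case by simp
      next
        case (Suc n)
        define k where "k = \<lfloor>2 ^ Suc n * x\<rfloor>"
        define l where "l = \<lfloor>2 ^ Suc n * y\<rfloor>"
        have kl: "k div 2 = l div 2" using Suc fl by (simp add: k_def l_def del: power_Suc)
        have "even k \<longleftrightarrow> even l"
        proof (rule ccontr)
          assume "(even k) \<noteq> (even l)"
          moreover have "\<psi> x \<in> N (Suc n) k" "\<psi> y \<in> N (Suc n) l"
            using \<psi>[of x "Suc n"] \<psi>[of y "Suc n"] by (auto simp: c_def k_def l_def)
          ultimately show False
            using LR[OF bigN, of n "k div 2" n] eq kl by (auto simp: NS split: if_splits)
        qed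
        then have "k = l" using kl by presburger
        then show ?case by (simp add: k_def l_def)
      qed
      show "x = y"
      proof (rule ccontr)
        assume "x \<noteq> y"
        then obtain n where n: "(1 / 2) ^ n < \<bar>x - y\<bar>" using real_arch_pow_inv[of "\<bar>x - y\<bar>" "1/2"] by auto
        have "\<bar>2 ^ n * x - 2 ^ n * y\<bar> < 1" using same[of n] by linarith
        then have "2 ^ n * \<bar>x - y\<bar> < 1" by (simp add: right_diff_distrib[symmetric] abs_mult)
        then show False using n by (simp add: power_one_over field_simps)
      qed
    qed
  qed
qed

text \<open>That the target sets are arbitrary is decisive: one of them is the image of a Vitali set
  along a transversal.\<close>

lemma countable_range_if_all_preimages_borel:
  fixes F :: "'z::{complete_space,second_countable_topology} \<Rightarrow> 'd"
  assumes F: "\<And>B. F -` B \<in> sets borel"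
  shows "countable (range F)"
proof (rule ccontr)
  assume unc: "uncountable (range F)"
  obtain \<B> :: "'z set set" where \<B>: "countable \<B>" "topological_basis \<B>"
    using ex_countable_basis by blast
  have "\<B> \<noteq> {}"
    using \<B>(2) by (metis UNIV_I empty_iff open_UNIV topological_basisE)
  define U where "U = from_nat_into \<B>"
  have U: "range U = \<B>" unfolding U_def by (rule range_from_nat_into) fact+
  \<comment> \<open>The target has no topology, so its separating sets come from a countable basis
    of the domain, through a choice of preimages that is injective on the range of
    \<open>F\<close>.\<close>
  define A where "A k = {d. inv_into UNIV F d \<in> U k}" for k :: nat
  have A: "\<exists>k. F u \<in> A k \<and> F v \<notin> A k" if "F u \<noteq> F v" for u v
  proof -
    have "inv_into UNIV F (F u) \<noteq> inv_into UNIV F (F v)" using that by (metis f_inv_into_f rangeI)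
    then obtain W where W: "open W" "inv_into UNIV F (F u) \<in> W" "inv_into UNIV F (F v) \<notin> W"
      using t1_space[of "inv_into UNIV F (F u)" "inv_into UNIV F (F v)"] by auto
    obtain V where V: "V \<in> \<B>" "inv_into UNIV F (F u) \<in> V" "V \<subseteq> W"
      using topological_basisE[OF \<B>(2) W(1,2)] by metis
    from V(1) U obtain k where "V = U k" by blast
    with V W show ?thesis by (auto simp: A_def)
  qed
  obtain Q where Q: "closed Q" "fst ` Q = UNIV" "\<And>k. clopen_lift Q (F -` A k)"
    using countable_clopen_lift[of "\<lambda>k. F -` A k", OF borel_clopen_lift[OF F]] by metis
  define G where "G w = F (fst w)" for w :: "'z \<times> (nat \<Rightarrow> real)"
  have "G ` Q = range F" using Q(2) by (metis G_def image_cong image_image)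
  then have uncG: "uncountable (G ` Q)" using unc by simp
  have sepG: "\<exists>U V. open U \<and> open V \<and> x \<in> U \<and> y \<in> V \<and> G ` (Q \<inter> U) \<inter> G ` (Q \<inter> V) = {}"
    if xy: "x \<in> Q" "y \<in> Q" "G x \<noteq> G y" for x y
  proof -
    obtain k where k: "G x \<in> A k" "G y \<notin> A k"
      using A[of "fst x" "fst y"] xy(3) by (auto simp: G_def)
    \<comment> \<open>\<open>C\<close> and \<open>D\<close> are closed and partition
      \<open>Q\<close>, so their complements are open and separate the values.\<close>
    define C where "C = Q \<inter> (F -` A k) \<times> UNIV"
    define D where "D = Q \<inter> (- (F -` A k)) \<times> UNIV"
    have closed: "closed C" "closed D" using Q(3)[of k] by (auto simp: C_def D_def clopen_lift_def)
    have inA: "G w \<in> A k" if "w \<in> Q \<inter> - D" for w using that by (cases w) (auto simp: D_def G_def)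
    have notA: "G w \<notin> A k" if "w \<in> Q \<inter> - C" for w using that by (cases w) (auto simp: C_def G_def)
    have disj: "G ` (Q \<inter> - D) \<inter> G ` (Q \<inter> - C) = {}"
    proof (rule equals0I)
      fix d assume "d \<in> G ` (Q \<inter> - D) \<inter> G ` (Q \<inter> - C)"
      then obtain u v where "u \<in> Q \<inter> - D" "v \<in> Q \<inter> - C" "d = G u" "d = G v" by blast
      then show False using inA[of u] notA[of v] by simp
    qed
    have "x \<in> - D" "y \<in> - C" using k by (auto simp: C_def D_def G_def mem_Times_iff)
    with closed disj have "open (- D) \<and> open (- C) \<and> x \<in> - D \<and> y \<in> - C \<and>
        G ` (Q \<inter> - D) \<inter> G ` (Q \<inter> - C) = {}"
      by (simp only: open_Compl simp_thms)
    then show ?thesis by blast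
  qed
  obtain \<psi> :: "real \<Rightarrow> 'z \<times> (nat \<Rightarrow> real)"
    where \<psi>: "\<psi> \<in> borel_measurable borel" "range \<psi> \<subseteq> Q" "inj_on (G \<circ> \<psi>) {0..<1}"
    by (rule uncountable_image_borel_transversal[OF Q(1) uncG sepG])
  obtain S :: "real set" where S: "S \<subseteq> {0..<1}" "S \<notin> sets borel"
    using exists_non_borel_subset by blast
  \<comment> \<open>\<open>E\<close> is Borel by the assumption on \<open>F\<close>, and injectivity
    on [0, 1) shows that \<open>E\<close> meets this interval exactly in \<open>S\<close>.\<close>
  define E where "E = (\<lambda>x. fst (\<psi> x)) -` (F -` ((G \<circ> \<psi>) ` S))"
  have E: "x \<in> E \<longleftrightarrow> (\<exists>y\<in>S. (G \<circ> \<psi>) x = (G \<circ> \<psi>) y)" for x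
    unfolding E_def G_def vimage_eq image_iff comp_def by (rule refl)
  have SE: "S = {0..<1} \<inter> E"
  proof (intro equalityI subsetI)
    fix x assume "x \<in> {0..<1} \<inter> E"
    then obtain y where y: "x \<in> {0..<1}" "y \<in> S" "(G \<circ> \<psi>) x = (G \<circ> \<psi>) y" using E[of x] by blast
    then have "x = y" using S(1) by (intro inj_onD[OF \<psi>(3)]) blast+
    then show "x \<in> S" using y(2) by (rule ssubst)
  qed (use S(1) E in blast)
  have "{0..<1} \<inter> E \<in> sets borel"
  proof (intro sets.Int)
    have "(\<lambda>x. fst (\<psi> x)) \<in> borel_measurable borel"
      by (rule measurable_compose[OF \<psi>(1)]) (intro borel_measurable_continuous_onI continuous_on_fst continuous_on_id)
    then show "E \<in> sets borel" unfolding E_def by (rule measurable_sets_borel[OF _ F])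
  qed simp
  then have "S \<in> sets borel" by (rule subst[of "{0..<1} \<inter> E" S, rotated]) (rule SE[symmetric])
  with S(2) show False by (rule notE)
qed

section \<open>Unique liftings\<close>

text \<open>Passes from the \<open>locally\<close> predicate on subsets to the notion for abstract
  topologies in which test spaces are formulated.\<close>

lemma convex_imp_locally_path_connected_space:
  fixes S :: "'e::real_normed_vector set"
  assumes "convex S"
  shows "locally_path_connected_space (top_of_set S)"
  unfolding locally_path_connected_space_def neighbourhood_base_of
proof (intro allI impI)
  fix W x assume "openin (top_of_set S) W \<and> x \<in> W"
  then obtain U V where UV: "openin (top_of_set S) U" "path_connected V" "x \<in> U" "U \<subseteq> V" "V \<subseteq> W"
    using convex_imp_locally_path_connected[OF assms] by (metis locallyE)
  have "V \<subseteq> S" using UV \<open>openin (top_of_set S) W \<and> x \<in> W\<close> openin_imp_subset by blast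
  then have "path_connectedin (top_of_set S) V"
    using UV(2) by (simp add: path_connectedin_def subtopology_subtopology Int_absorb1)
  then show "\<exists>U V. openin (top_of_set S) U \<and> path_connectedin (top_of_set S) V \<and> x \<in> U \<and> U \<subseteq> V \<and> V \<subseteq> W"
    using UV by blast
qed

text \<open>Transport of structure: test spaces have carriers in one fixed type, and a space is
  copied into it along an injection.\<close>

lemma homeomorphic_maps_pullback_inv_into:
  assumes "inj_on i (topspace X)"
  defines "j \<equiv> inv_into (topspace X) i"
  shows "homeomorphic_maps (pullback_topology (i ` topspace X) j X) X j i"
  unfolding homeomorphic_maps_def
proof (intro conjI)
  let ?Y = "pullback_topology (i ` topspace X) j X"
  have ji: "j (i x) = x" if "x \<in> topspace X" for x
    using that assms by (simp add: j_def)
  show "continuous_map ?Y X j"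
    using continuous_map_pullback[OF continuous_map_id, of "i ` topspace X" j X] by simp
  show "continuous_map X ?Y i"
  proof (rule continuous_map_pullback')
    show "continuous_map X X (j \<circ> i)"
      using continuous_map_eq[OF continuous_map_id, of X "j \<circ> i"] ji by simp
  qed auto
  show "\<forall>x\<in>topspace ?Y. i (j x) = x" using ji by (auto simp: topspace_pullback_topology)
  show "\<forall>y\<in>topspace X. j (i y) = y" using ji by simp
qed

text \<open>A convex set is path-connected, locally path-connected and simply connected, so its copy
  under \<open>i\<close> is an admissible test space for every continuous map. Liftings are
  translated by composing with \<open>i\<close> and its inverse \<open>j\<close>.\<close>

lemma
  fixes p :: "'b::topological_space \<Rightarrow> 'a::topological_space"
    and S :: "'e::real_normed_vector set" and i :: "'e \<Rightarrow> 'c"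
  assumes lift: "unique_pointed_liftings TYPE('c) p" and inj: "inj_on i S" and "convex S"
  shows convex_lifting_exists:
      "\<lbrakk>continuous_on S f; y \<in> S; p xt = f y\<rbrakk> \<Longrightarrow> \<exists>g. continuous_on S g \<and> g y = xt \<and> (\<forall>z\<in>S. p (g z) = f z)"
    and convex_lifting_unique:
      "\<lbrakk>continuous_on UNIV p; continuous_on S g; continuous_on S g'; y \<in> S; g y = g' y;
        \<And>z. z \<in> S \<Longrightarrow> p (g z) = p (g' z); z \<in> S\<rbrakk> \<Longrightarrow> g z = g' z"
proof -
  define j where "j = inv_into S i"
  define Y where "Y = pullback_topology (i ` S) j (top_of_set S)"
  have hm: "homeomorphic_maps Y (top_of_set S) j i"
    using homeomorphic_maps_pullback_inv_into[of i "top_of_set S"] inj by (simp add: Y_def j_def)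
  have jc: "continuous_map Y (top_of_set S) j" and ic: "continuous_map (top_of_set S) Y i"
    using hm by (auto simp: homeomorphic_maps_def)
  have ji: "j (i x) = x" if "x \<in> S" for x
    using hm that by (auto simp: homeomorphic_maps_def)
  have top: "topspace Y = i ` S"
    by (auto simp: Y_def topspace_pullback_topology j_def inj)
  have homeo: "Y homeomorphic_space top_of_set S"
    using hm by (auto simp: homeomorphic_space_def)
  have pc: "path_connected_space Y"
    using homeomorphic_path_connected_space[OF homeo] convex_imp_path_connected[OF \<open>convex S\<close>] by simp
  have lpc: "locally_path_connected_space Y"
    using homeomorphic_locally_path_connected_space[OF homeo]
      convex_imp_locally_path_connected_space[OF \<open>convex S\<close>] by blast
  have pi1: "pi1_trivial Y (i y) (f \<circ> j)" if f: "continuous_on S f" and y: "y \<in> S"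
    for f :: "'e \<Rightarrow> 'a" and y
    unfolding pi1_trivial_def
  proof (intro allI impI)
    fix \<gamma> assume \<gamma>: "pathin Y \<gamma> \<and> \<gamma> 0 = i y \<and> \<gamma> 1 = i y"
    then have "pathin (top_of_set S) (j \<circ> \<gamma>)" using pathin_compose jc by blast
    then have path: "path (j \<circ> \<gamma>)" "path_image (j \<circ> \<gamma>) \<subseteq> S"
      by (auto simp: pathin_def path_def path_image_def)
    have ends: "pathstart (j \<circ> \<gamma>) = y" "pathfinish (j \<circ> \<gamma>) = y"
      using \<gamma> ji y by (auto simp: pathstart_def pathfinish_def)
    have "homotopic_paths S (j \<circ> \<gamma>) (linepath y y)"
      using convex_imp_simply_connected[OF \<open>convex S\<close>] path ends y
      unfolding simply_connected_eq_homotopic_paths by simp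
    then have "homotopic_paths UNIV (f \<circ> (j \<circ> \<gamma>)) (f \<circ> linepath y y)"
      by (rule homotopic_paths_continuous_image[OF _ f]) auto
    moreover have "f \<circ> linepath y y = (\<lambda>_. (f \<circ> j) (i y))"
      using ji y by (auto simp: linepath_def algebra_simps scaleR_left_distrib[symmetric])
    ultimately show "homotopic_paths UNIV (f \<circ> j \<circ> \<gamma>) (\<lambda>_. (f \<circ> j) (i y))"
      by (simp add: comp_assoc)
  qed
  have ex1: "\<exists>!g. g \<in> extensional (topspace Y) \<and> continuous_map Y euclidean g \<and> g (i y) = xt \<and>
              (\<forall>z\<in>topspace Y. p (g z) = (f \<circ> j) z)"
    if f: "continuous_on S f" and y: "y \<in> S" and xt: "p xt = f y" for f y xt
  proof -
    have "continuous_map Y euclidean (f \<circ> j)"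
      using jc by (rule continuous_map_compose) (use f in simp)
    then have "path_connected_space Y \<and> locally_path_connected_space Y \<and> i y \<in> topspace Y \<and>
        continuous_map Y euclidean (f \<circ> j) \<and> pi1_trivial Y (i y) (f \<circ> j) \<and> p xt = (f \<circ> j) (i y)"
      using pc lpc pi1[OF f y] y xt top ji by simp
    then show ?thesis
      using lift unfolding unique_pointed_liftings_def by blast
  qed
  show "\<exists>g. continuous_on S g \<and> g y = xt \<and> (\<forall>z\<in>S. p (g z) = f z)"
    if f: "continuous_on S f" and y: "y \<in> S" and xt: "p xt = f y"
  proof -
    obtain g where g: "continuous_map Y euclidean g" "g (i y) = xt" "\<And>z. z \<in> topspace Y \<Longrightarrow> p (g z) = f (j z)"
      using ex1[OF f y xt] by auto
    have "continuous_map (top_of_set S) euclidean (g \<circ> i)"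
      using ic g(1) by (rule continuous_map_compose)
    then show ?thesis using g ji top by (intro exI[of _ "g \<circ> i"]) auto
  qed
  show "g z = g' z" if pc: "continuous_on UNIV p" and g: "continuous_on S g" and g': "continuous_on S g'"
    and y: "y \<in> S" and eq: "g y = g' y" and lifts: "\<And>z. z \<in> S \<Longrightarrow> p (g z) = p (g' z)" and z: "z \<in> S"
    for g g' y z
  proof -
    \<comment> \<open>Restriction makes both lifts extensional, so they solve the same lifting
      problem, that of \<open>p \<circ> g\<close> from the point \<open>g y\<close>.\<close>
    define L where "L h = restrict (h \<circ> j) (topspace Y)" for h :: "'e \<Rightarrow> 'b"
    have f: "continuous_on S (p \<circ> g)"
      using g pc by (meson continuous_on_compose continuous_on_subset subset_UNIV)
    have cL: "continuous_map Y euclidean (L h)" if "continuous_on S h" for h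
    proof -
      have "continuous_map Y euclidean (h \<circ> j)"
        using jc by (rule continuous_map_compose) (use that in simp)
      then show ?thesis unfolding L_def by (rule continuous_map_eq) simp
    qed
    have jS: "j z \<in> S" if "z \<in> topspace Y" for z using that top ji by auto
    let ?P = "\<lambda>h. h \<in> extensional (topspace Y) \<and> continuous_map Y euclidean h \<and> h (i y) = g y \<and>
              (\<forall>z\<in>topspace Y. p (h z) = ((p \<circ> g) \<circ> j) z)"
    have "\<exists>!h. ?P h" by (rule ex1[OF f y]) simp
    moreover have "?P (L g)" using cL[OF g] top y ji by (auto simp: L_def)
    moreover have "?P (L g')" using cL[OF g'] top y ji eq lifts jS by (auto simp: L_def)
    ultimately have "L g = L g'" by blast
    then have "L g (i z) = L g' (i z)" by simp
    then show ?thesis using z top ji by (simp add: L_def)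
  qed
qed

text \<open>The plane has the cardinality of the line; this is what admits the unit square as a test
  space.\<close>

lemma exists_inj_square_into_sum_real: "\<exists>i :: real \<times> real \<Rightarrow> 'b + real. inj i"
proof -
  have "|UNIV \<times> UNIV :: (real \<times> real) set| =o |UNIV :: real set|"
    by (rule card_of_Times_same_infinite) (simp add: infinite_UNIV_char_0)
  then obtain h :: "real \<times> real \<Rightarrow> real" where "bij_betw h (UNIV \<times> UNIV) UNIV"
    using card_of_ordIso by blast
  then have "inj (Inr \<circ> h :: real \<times> real \<Rightarrow> 'b + real)"
    by (intro inj_compose inj_Inr) (simp add: bij_betw_def)
  then show ?thesis by blast
qed

section \<open>Paths, fibres and deck transformations\<close>

context
  fixes p :: "'b::topological_space \<Rightarrow> 'a::topological_space"
  assumes cov: "generalized_universal_covering TYPE('b + real) p"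
begin

lemma continuous_covering: "continuous_on A p"
  using cov unfolding generalized_universal_covering_def by (meson continuous_on_subset subset_UNIV)

lemma path_lifting_unique:
  fixes g g' :: "real \<Rightarrow> 'b"
  assumes "continuous_on {0..1} g" "continuous_on {0..1} g'" "y \<in> {0..1}" "g y = g' y"
    "\<And>t. t \<in> {0..1} \<Longrightarrow> p (g t) = p (g' t)" "t \<in> {0..1}"
  shows "g t = g' t"
proof (rule convex_lifting_unique[where p = p and S = "{0..1}" and i = "Inr :: real \<Rightarrow> 'b + real"])
  show "unique_pointed_liftings TYPE('b + real) p"
    using cov unfolding generalized_universal_covering_def by blast
qed (use assms continuous_covering in auto)

lemma square_lifting_exists:
  fixes f :: "real \<times> real \<Rightarrow> 'a"
  assumes "continuous_on ({0..1} \<times> {0..1}) f" "p xt = f (0, 0)"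
  obtains g where "continuous_on ({0..1} \<times> {0..1}) g" "g (0, 0) = xt"
    "\<And>s t. s \<in> {0..1} \<Longrightarrow> t \<in> {0..1} \<Longrightarrow> p (g (s, t)) = f (s, t)"
proof -
  obtain i :: "real \<times> real \<Rightarrow> 'b + real" where i: "inj i"
    using exists_inj_square_into_sum_real by blast
  have "\<exists>g. continuous_on ({0..1} \<times> {0..1}) g \<and> g (0, 0) = xt \<and> (\<forall>z\<in>{0..1} \<times> {0..1}. p (g z) = f z)"
  proof (rule convex_lifting_exists[where i = i])
    show "unique_pointed_liftings TYPE('b + real) p"
      using cov unfolding generalized_universal_covering_def by blast
    show "inj_on i ({0..1} \<times> {0..1})" using i by (rule inj_on_subset) simp
  qed (use assms in \<open>auto intro: convex_Times\<close>)
  then show ?thesis using that by force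
qed

text \<open>Lift the null-homotopy to the square. The edge over homotopy time 0 is
  \<open>\<gamma>\<close> by uniqueness; the other three edges lie over the constant
  \<open>x0\<close>, so they are constant, and they connect \<open>\<gamma> 0\<close> with
  \<open>\<gamma> 1\<close>.\<close>

lemma lift_of_null_homotopic_loop_closed:
  assumes \<gamma>: "path \<gamma>" and start: "p (\<gamma> 0) = x0"
    and null: "homotopic_paths UNIV (p \<circ> \<gamma>) (\<lambda>_. x0)"
  shows "\<gamma> 1 = \<gamma> 0"
proof -
  obtain H :: "real \<times> real \<Rightarrow> 'a" where H: "continuous_on ({0..1} \<times> {0..1}) H"
    "\<And>t. t \<in> {0..1} \<Longrightarrow> H (0, t) = p (\<gamma> t)" "\<And>t. t \<in> {0..1} \<Longrightarrow> H (1, t) = x0"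
    "\<And>s. s \<in> {0..1} \<Longrightarrow> H (s, 0) = x0" "\<And>s. s \<in> {0..1} \<Longrightarrow> H (s, 1) = p (\<gamma> 1)"
    using null start unfolding homotopic_paths by (auto simp: pathstart_def pathfinish_def)
  obtain g where g: "continuous_on ({0..1} \<times> {0..1}) g" "g (0, 0) = \<gamma> 0"
    "\<And>s t. s \<in> {0..1} \<Longrightarrow> t \<in> {0..1} \<Longrightarrow> p (g (s, t)) = H (s, t)"
    using square_lifting_exists[OF H(1), of "\<gamma> 0"] H(2)[of 0] by auto
  have p1: "p (\<gamma> 1) = x0" using H(3)[of 1] H(5)[of 1] by simp
  have row: "continuous_on {0..1} (\<lambda>t. g (s, t))" if "s \<in> {0..1}" for s
    by (rule continuous_on_compose2[OF g(1)]) (use that in \<open>auto intro!: continuous_intros\<close>)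
  have col: "continuous_on {0..1} (\<lambda>s. g (s, t))" if "t \<in> {0..1}" for t
    by (rule continuous_on_compose2[OF g(1)]) (use that in \<open>auto intro!: continuous_intros\<close>)
  have "g (0, 1) = \<gamma> 1"
    by (rule path_lifting_unique[where g = "\<lambda>t. g (0, t)" and y = 0])
      (use \<gamma> row g H in \<open>auto simp: path_def\<close>)
  moreover have left: "g (s, 0) = \<gamma> 0" if "s \<in> {0..1}" for s
    by (rule path_lifting_unique[where g = "\<lambda>s. g (s, 0)" and g' = "\<lambda>_. \<gamma> 0" and y = 0])
      (use col g H start that in auto)
  moreover have "g (1, 1) = g (1, 0)"
    by (rule path_lifting_unique[where g = "\<lambda>t. g (1, t)" and g' = "\<lambda>_. g (1, 0)" and y = 0])
      (use row g H in auto)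
  moreover have "g (1, 1) = g (0, 1)"
    by (rule path_lifting_unique[where g = "\<lambda>s. g (s, 1)" and g' = "\<lambda>_. g (0, 1)" and y = 0])
      (use col g H p1 in auto)
  ultimately show ?thesis using left[of 1] by simp
qed

text \<open>A second fibre point in a small path-connected neighbourhood could be joined to
  \<open>d\<close> by a path that projects to a loop in \<open>V\<close>. This loop is
  null-homotopic in the base, so the path would be closed.\<close>

lemma fibre_discrete:
  assumes "semilocally_simply_connected_at x0" "p d = x0"
  obtains W where "open W" "d \<in> W" "W \<inter> p -` {x0} = {d}"
proof -
  obtain V where V: "x0 \<in> interior V" "pi1_trivial (top_of_set V) x0 id"
    using assms(1) unfolding semilocally_simply_connected_at_def by blast
  have "open (p -` interior V)"
    by (rule open_vimage[OF open_interior continuous_covering])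
  moreover have "d \<in> p -` interior V" using V assms by simp
  moreover have "locally path_connected (UNIV :: 'b set)"
    using cov unfolding generalized_universal_covering_def by blast
  \<comment> \<open>\<open>W\<close> is path-connected but perhaps not open; the open set
    \<open>U\<close> inside it is the neighbourhood that isolates \<open>d\<close>.\<close>
  ultimately obtain U W where UW: "open U" "path_connected W" "d \<in> U" "U \<subseteq> W" "W \<subseteq> p -` interior V"
    by (metis locallyE open_openin subtopology_UNIV)
  have only: "e = d" if e: "e \<in> U" "p e = x0" for e
  proof -
    have "e \<in> W" "d \<in> W" using e UW by auto
    then obtain \<gamma> where \<gamma>: "path \<gamma>" "path_image \<gamma> \<subseteq> W" "pathstart \<gamma> = d" "pathfinish \<gamma> = e"
      using UW(2) unfolding path_connected_def by metis
    have "path (p \<circ> \<gamma>)" using \<gamma>(1) continuous_covering by (rule path_continuous_image)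
    moreover have "p (\<gamma> t) \<in> V" if "t \<in> {0..1}" for t
      using that \<gamma>(2) UW(5) interior_subset by (fastforce simp: path_image_def)
    ultimately have "pathin (top_of_set V) (p \<circ> \<gamma>)"
      by (auto simp: pathin_def path_def)
    then have "homotopic_paths UNIV (id \<circ> (p \<circ> \<gamma>)) (\<lambda>_. id x0)"
      using V(2) \<gamma> e assms(2) unfolding pi1_trivial_def pathstart_def pathfinish_def by simp
    then have "\<gamma> 1 = \<gamma> 0"
      using \<gamma>(1,3) assms(2) by (intro lift_of_null_homotopic_loop_closed) (auto simp: pathstart_def)
    then show ?thesis using \<gamma> by (simp add: pathstart_def pathfinish_def)
  qed
  show ?thesis
  proof (rule that[OF UW(1,3)])
    show "U \<inter> p -` {x0} = {d}" using UW(3) assms(2) by (auto dest: only)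
  qed
qed

text \<open>\<open>simply_connected\<close> is defined by free homotopy of all loops; a homotopy
  between two constant loops traces a path between their values.\<close>

lemma path_between:
  obtains \<gamma> where "path \<gamma>" "\<gamma> 0 = (a :: 'b)" "\<gamma> 1 = b"
proof -
  have "simply_connected (UNIV :: 'b set)"
    using cov unfolding generalized_universal_covering_def by blast
  then have "homotopic_loops UNIV (\<lambda>_. a) (\<lambda>_. b)"
    by (simp add: simply_connected_def path_def pathstart_def pathfinish_def)
  then have "path_component UNIV a b"
    using homotopic_loops_imp_path_component_value[of UNIV "\<lambda>_. a" "\<lambda>_. b" 0] by simp
  then show ?thesis
    using that unfolding path_component_def pathstart_def pathfinish_def by metis
qed

text \<open>Freeness of the deck action: \<open>h\<close> and \<open>h'\<close> send a path from
  \<open>a\<close> to \<open>b\<close> to two lifts of one path that agree at time 0.\<close>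

lemma deck_group_eqI:
  assumes h: "h \<in> deck_group p" and h': "h' \<in> deck_group p" and eq: "h a = h' a"
  shows "h = h'"
proof
  fix b
  obtain \<gamma> where \<gamma>: "path \<gamma>" "\<gamma> 0 = a" "\<gamma> 1 = b" by (rule path_between)
  have cont: "continuous_on {0..1} (k \<circ> \<gamma>)" and lift: "p (k x) = p x" if k: "k \<in> deck_group p" for k x
  proof -
    have "continuous_on UNIV k" "p \<circ> k = p"
      using k by (auto simp: deck_group_def homeomorphism_def)
    then show "p (k x) = p x" by (metis comp_apply)
    show "continuous_on {0..1} (k \<circ> \<gamma>)"
      using \<gamma>(1)[unfolded path_def] continuous_on_subset[OF \<open>continuous_on UNIV k\<close> subset_UNIV]
      by (rule continuous_on_compose)
  qed
  have "(h \<circ> \<gamma>) 1 = (h' \<circ> \<gamma>) 1"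
    by (rule path_lifting_unique[where y = 0]) (use cont h h' eq \<gamma> lift in auto)
  then show "h b = h' b" using \<gamma> by simp
qed

end

section \<open>The space of loops\<close>

lemma singular_simplex_euclidean_iff:
  "singular_simplex n euclidean \<sigma> \<longleftrightarrow>
     continuous_on (standard_simplex n) \<sigma> \<and> \<sigma> \<in> extensional (standard_simplex n)"
  by (simp add: singular_simplex_def euclidean_product_topology)

text \<open>The barycentric coordinate \<open>x 1\<close> of vertex 1 serves as time;
  \<open>restrict\<close> yields the extensional representative that \<open>singular_simplex\<close>
  demands.\<close>

definition simplex_of_path :: "(real \<Rightarrow> 'a) \<Rightarrow> (nat \<Rightarrow> real) \<Rightarrow> 'a" where
  "simplex_of_path \<gamma> = restrict (\<lambda>x. \<gamma> (x 1)) (standard_simplex 1)"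

text \<open>The affine parametrization of the standard 1-simplex, inverse to the coordinate
  \<open>x 1\<close> used in \<open>simplex_of_path\<close>.\<close>

definition segment_point :: "real \<Rightarrow> nat \<Rightarrow> real" where
  "segment_point t = (\<lambda>j. if j = 0 then 1 - t else if j = 1 then t else 0)"

lemma segment_point_1 [simp]: "segment_point t 1 = t" "segment_point t (Suc 0) = t"
  by (simp_all add: segment_point_def)

lemma segment_point_in_simplex: "t \<in> {0..1} \<Longrightarrow> segment_point t \<in> standard_simplex 1"
  by (auto simp: standard_simplex_def segment_point_def)

lemma in_standard_simplex_1D:
  assumes "x \<in> standard_simplex 1"
  shows "x 1 \<in> {0..1}" "segment_point (x 1) = x"
proof -
  have x: "\<And>i. 0 \<le> x i \<and> x i \<le> 1" "\<And>i. i > 1 \<Longrightarrow> x i = 0" "x 0 + x 1 = 1"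
    using assms by (auto simp: standard_simplex_def)
  then show "x 1 \<in> {0..1}" by simp
  show "segment_point (x 1) = x"
  proof
    fix j :: nat
    consider "j = 0" | "j = 1" | "j > 1" by linarith
    then show "segment_point (x 1) j = x j"
      using x by cases (auto simp: segment_point_def)
  qed
qed

lemma vertex_eq_segment_point:
  "(\<lambda>j. if j = 0 then 1 else 0) = segment_point 0" "(\<lambda>j. if j = 1 then 1 else 0) = segment_point 1"
  by (auto simp: segment_point_def)

lemma continuous_on_segment_point: "continuous_on A segment_point"
proof (rule continuous_on_coordinatewise_then_product)
  show "continuous_on A (\<lambda>t. segment_point t j)" for j
    unfolding segment_point_def by (cases "j = 0"; cases "j = 1") (auto intro: continuous_intros)
qed

lemma singular_1_simplices_iff:
  "\<sigma> \<in> singular_1_simplices A \<longleftrightarrow>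
     continuous_on (standard_simplex 1) \<sigma> \<and> \<sigma> \<in> extensional (standard_simplex 1) \<and>
     \<sigma> (segment_point 0) \<in> A \<and> \<sigma> (segment_point 1) \<in> A"
  by (auto simp: singular_1_simplices_def singular_simplex_euclidean_iff
      vertex_eq_segment_point[simplified])

lemma simplex_of_path_in_singular_1_simplices:
  assumes "continuous_on {0..1} \<gamma>" "\<gamma> 0 \<in> A" "\<gamma> 1 \<in> A"
  shows "simplex_of_path \<gamma> \<in> singular_1_simplices A"
proof -
  have "continuous_on (standard_simplex 1) (\<lambda>x. \<gamma> (x 1))"
  proof (rule continuous_on_compose2[OF assms(1)])
    show "continuous_on (standard_simplex 1) (\<lambda>x. x 1 :: real)"
      by (rule continuous_on_product_then_coordinatewise) (rule continuous_on_id)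
    show "(\<lambda>x. x 1) ` standard_simplex 1 \<subseteq> {0..1}" using in_standard_simplex_1D(1) by blast
  qed
  then have "continuous_on (standard_simplex 1) (simplex_of_path \<gamma>)"
    by (rule continuous_on_eq) (simp add: simplex_of_path_def)
  then show ?thesis
    using assms(2,3) segment_point_in_simplex[of 0] segment_point_in_simplex[of 1]
    by (simp add: singular_1_simplices_iff simplex_of_path_def)
qed

lemma simplex_of_path_of_simplex:
  assumes "\<sigma> \<in> extensional (standard_simplex 1)"
  shows "simplex_of_path (\<sigma> \<circ> segment_point) = \<sigma>"
proof (rule extensionalityI[OF _ assms])
  show "simplex_of_path (\<sigma> \<circ> segment_point) x = \<sigma> x" if "x \<in> standard_simplex 1" for x
    using in_standard_simplex_1D(2)[OF that] that by (simp add: simplex_of_path_def)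
qed (simp add: simplex_of_path_def)

lemma continuous_on_path_of_simplex:
  assumes "continuous_on (standard_simplex 1) \<sigma>"
  shows "continuous_on {0..1} (\<sigma> \<circ> segment_point)"
  using continuous_on_segment_point assms segment_point_in_simplex
  by (intro continuous_on_compose) (auto intro: continuous_on_subset)

section \<open>Coding loops by points of a Polish space\<close>

lemma rational_sequence_in_unit_interval:
  assumes "x \<in> {0..1::real}"
  obtains r :: "nat \<Rightarrow> rat" where "\<And>k. r k \<in> {0..1}" "(\<lambda>k. of_rat (r k)) \<longlonglongrightarrow> x"
proof -
  have "\<exists>q :: rat. q \<in> {0..1} \<and> \<bar>of_rat q - x\<bar> \<le> 1 / (real k + 1)" for k :: nat
  \<comment> \<open>At the right end there is no room for a rational above \<open>x\<close> inside
    the interval, so 1 itself is taken.\<close>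
  proof (cases "x = 1")
    case True
    then show ?thesis by (intro exI[of _ 1]) simp
  next
    case False
    then have "x < min 1 (x + 1 / (real k + 1))" using assms by auto
    then obtain q where q: "x < of_rat q" "of_rat q < min 1 (x + 1 / (real k + 1))"
      using of_rat_dense by blast
    have "0 \<le> x" using assms by simp
    then have "(0::real) < of_rat q" using q(1) by (rule le_less_trans)
    moreover have "of_rat q < (1::real)" using q(2) by (simp only: min_less_iff_conj)
    ultimately have "q \<in> {0..1}" by simp
    then show ?thesis using q by (intro exI[of _ q]) auto
  qed
  then obtain r :: "nat \<Rightarrow> rat" where r: "\<And>k. r k \<in> {0..1}" "\<And>k. \<bar>of_rat (r k) - x\<bar> \<le> 1 / (real k + 1)"
    by metis
  have "(\<lambda>k. 1 / (real k + 1)) \<longlonglongrightarrow> 0"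
    using LIMSEQ_inverse_real_of_nat by (simp add: inverse_eq_divide add.commute)
  then have "(\<lambda>k. of_rat (r k) - x) \<longlonglongrightarrow> 0"
    by (rule tendsto_0_le[where K = 1]) (use r(2) in auto)
  then have "(\<lambda>k. of_rat (r k)) \<longlonglongrightarrow> x" by (rule LIM_zero_cancel)
  then show ?thesis using that r(1) by blast
qed

text \<open>A code of a loop consists of its values at rational times and of a modulus of uniform
  continuity \<open>n \<mapsto> 1 / m n\<close>. The strict inequality in the premise makes the condition closed.\<close>

definition loop_codes :: "'a::metric_space \<Rightarrow> ((rat \<Rightarrow> 'a) \<times> (nat \<Rightarrow> real)) set" where
  "loop_codes x0 = {c. fst c 0 = x0 \<and> fst c 1 = x0 \<and>
     (\<forall>n. \<forall>q\<in>{0..1}. \<forall>r\<in>{0..1}. \<bar>of_rat q - of_rat r\<bar> * snd c n < 1 \<longrightarrow>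
        dist (fst c q) (fst c r) \<le> 1 / (real n + 1))}"

text \<open>A choice of continuous extension; for a code of a loop, density of the rationals
  determines it on [0, 1].\<close>

definition decode :: "(rat \<Rightarrow> 'a::metric_space) \<times> (nat \<Rightarrow> real) \<Rightarrow> real \<Rightarrow> 'a" where
  "decode c = (SOME g. continuous_on {0..1} g \<and> (\<forall>q\<in>{0..1}. g (of_rat q) = fst c q))"

lemma closed_loop_codes: "closed (loop_codes (x0 :: 'a::metric_space))"
proof -
  have f: "continuous_on UNIV (\<lambda>c :: (rat \<Rightarrow> 'a) \<times> (nat \<Rightarrow> real). fst c q)" for q
    by (rule continuous_on_product_then_coordinatewise[OF continuous_on_fst[OF continuous_on_id]])
  have m: "continuous_on UNIV (\<lambda>c :: (rat \<Rightarrow> 'a) \<times> (nat \<Rightarrow> real). snd c n)" for n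
    by (rule continuous_on_product_then_coordinatewise[OF continuous_on_snd[OF continuous_on_id]])
  \<comment> \<open>Each implication becomes a union of two closed conditions, the negated premise
    and the conclusion.\<close>
  have "loop_codes x0 = {c. fst c 0 = x0} \<inter> {c. fst c 1 = x0} \<inter>
     (\<Inter>n. \<Inter>q\<in>{0..1}. \<Inter>r\<in>{0..1}. {c. 1 \<le> \<bar>of_rat q - of_rat r\<bar> * snd c n} \<union>
        {c. dist (fst c q) (fst c r) \<le> 1 / (real n + 1)})"
    unfolding loop_codes_def by (auto simp: not_less[symmetric])
  moreover have "closed {c :: (rat \<Rightarrow> 'a) \<times> (nat \<Rightarrow> real). fst c q = x0}" for q
    by (intro closed_Collect_eq f continuous_on_const)
  moreover have "closed {c :: (rat \<Rightarrow> 'a) \<times> (nat \<Rightarrow> real). 1 \<le> a * snd c n}" for a n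
    by (intro closed_Collect_le m continuous_on_const continuous_on_mult)
  moreover have "closed {c :: (rat \<Rightarrow> 'a) \<times> (nat \<Rightarrow> real). dist (fst c q) (fst c r) \<le> a}" for q r a
    by (intro closed_Collect_le f continuous_on_const continuous_on_dist)
  ultimately show ?thesis by (simp only:) (intro closed_Int closed_INT ballI closed_Un)
qed

text \<open>The modulus makes the coded values uniformly continuous on the rationals of the
  interval, so by completeness they extend to the closure, which contains [0, 1].\<close>

lemma
  fixes c :: "(rat \<Rightarrow> 'a::complete_space) \<times> (nat \<Rightarrow> real)"
  assumes c: "c \<in> loop_codes x0"
  shows continuous_on_decode: "continuous_on {0..1} (decode c)"
    and decode_of_rat: "q \<in> {0..1} \<Longrightarrow> decode c (of_rat q) = fst c q"
proof -
  define X where "X = (of_rat :: rat \<Rightarrow> real) ` {0..1}"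
  define f where "f = fst c \<circ> inv_into UNIV (of_rat :: rat \<Rightarrow> real)"
  have inv: "inv_into UNIV (of_rat :: rat \<Rightarrow> real) (of_rat q) = q" for q
    by (rule inv_f_f) (auto simp: inj_def)
  have "uniformly_continuous_on X f"
    unfolding uniformly_continuous_on_def
  proof (intro allI impI)
    fix e :: real assume "e > 0"
    then obtain n where n: "1 / (real n + 1) < e"
      using reals_Archimedean[of e] by (auto simp: inverse_eq_divide add.commute)
    \<comment> \<open>The entry \<open>snd c n\<close> may be 0 or negative; the absolute value plus
      one gives a positive radius in every case.\<close>
    define d where "d = 1 / (\<bar>snd c n\<bar> + 1)"
    have "dist (f x') (f x) < e" if x: "x \<in> X" "x' \<in> X" "dist x' x < d" for x x'
    proof -
      obtain q r where qr: "q \<in> {0..1}" "r \<in> {0..1}" "x = of_rat q" "x' = of_rat r"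
        using x unfolding X_def by auto
      have "\<bar>of_rat r - of_rat q\<bar> * snd c n \<le> \<bar>of_rat r - of_rat q\<bar> * (\<bar>snd c n\<bar> + 1)"
        by (intro mult_left_mono) auto
      also have "\<dots> < d * (\<bar>snd c n\<bar> + 1)"
        using x(3) qr by (intro mult_strict_right_mono) (auto simp: dist_real_def)
      also have "\<dots> = 1" by (simp add: d_def field_simps)
      finally have "dist (fst c r) (fst c q) \<le> 1 / (real n + 1)"
        using c qr unfolding loop_codes_def by blast
      then show ?thesis using n qr by (simp add: f_def inv)
    qed
    moreover have "d > 0" by (simp add: d_def)
    ultimately show "\<exists>d>0. \<forall>x\<in>X. \<forall>x'\<in>X. dist x' x < d \<longrightarrow> dist (f x') (f x) < e" by blast
  qed
  then obtain g where g: "uniformly_continuous_on (closure X) g" "\<And>x. x \<in> X \<Longrightarrow> f x = g x"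
    using uniformly_continuous_on_extension_on_closure[of X f] by metis
  have "{0..1} \<subseteq> closure X"
  proof
    fix x :: real assume "x \<in> {0..1}"
    then obtain r :: "nat \<Rightarrow> rat" where "\<And>k. r k \<in> {0..1}" "(\<lambda>k. of_rat (r k)) \<longlonglongrightarrow> x"
      by (rule rational_sequence_in_unit_interval) blast
    then show "x \<in> closure X"
      unfolding closure_sequential X_def by (intro exI[of _ "\<lambda>k. of_rat (r k)"]) blast
  qed
  then have cont_g: "continuous_on {0..1} g"
    using g(1) uniformly_continuous_imp_continuous continuous_on_subset by blast
  have eq_g: "g (of_rat q) = fst c q" if "q \<in> {0..1}" for q
    using g(2)[of "of_rat q"] that by (auto simp: X_def f_def inv)
  have "\<exists>g :: real \<Rightarrow> 'a. continuous_on {0..1} g \<and> (\<forall>q\<in>{0..1}. g (of_rat q) = fst c q)"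
    by (intro exI[of _ g] conjI ballI cont_g eq_g)
  then have "continuous_on {0..1} (decode c) \<and> (\<forall>q\<in>{0..1}. decode c (of_rat q) = fst c q)"
    unfolding decode_def by (rule someI_ex)
  then show "continuous_on {0..1} (decode c)" "q \<in> {0..1} \<Longrightarrow> decode c (of_rat q) = fst c q"
    by blast+
qed

text \<open>Approximate \<open>x\<close> by rationals: the strict premise holds eventually along the
  sequence, and the non-strict conclusion passes to the limit.\<close>

lemma decode_modulus:
  fixes c :: "(rat \<Rightarrow> 'a::complete_space) \<times> (nat \<Rightarrow> real)"
  assumes c: "c \<in> loop_codes x0" and x: "x \<in> {0..1}" and q: "q \<in> {0..1}"
    and close: "\<bar>x - of_rat q\<bar> * snd c n < 1"
  shows "dist (decode c x) (fst c q) \<le> 1 / (real n + 1)"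
proof -
  obtain r :: "nat \<Rightarrow> rat" where r: "\<And>k. r k \<in> {0..1}" "(\<lambda>k. of_rat (r k)) \<longlonglongrightarrow> x"
    using rational_sequence_in_unit_interval[OF x] by metis
  have "(\<lambda>k. decode c (of_rat (r k))) \<longlonglongrightarrow> decode c x"
    by (rule continuous_on_tendsto_compose[OF continuous_on_decode[OF c] r(2) x]) (use r(1) in simp)
  then have "(\<lambda>k. fst c (r k)) \<longlonglongrightarrow> decode c x"
    using decode_of_rat[OF c] r(1) by simp
  then have lim: "(\<lambda>k. dist (fst c (r k)) (fst c q)) \<longlonglongrightarrow> dist (decode c x) (fst c q)"
    by (intro tendsto_dist tendsto_const)
  have "(\<lambda>k. \<bar>of_rat (r k) - of_rat q\<bar> * snd c n) \<longlonglongrightarrow> \<bar>x - of_rat q\<bar> * snd c n"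
    by (intro tendsto_intros r)
  then have "\<forall>\<^sub>F k in sequentially. \<bar>of_rat (r k) - of_rat q\<bar> * snd c n < 1"
    using close by (rule order_tendstoD)
  then have "\<forall>\<^sub>F k in sequentially. dist (fst c (r k)) (fst c q) \<le> 1 / (real n + 1)"
    by (rule eventually_mono) (use c r(1) q in \<open>auto simp: loop_codes_def\<close>)
  then show ?thesis by (rule tendsto_upperbound[OF lim]) simp
qed

text \<open>Uniform continuity supplies the modulus, and decoding returns \<open>\<gamma>\<close>
  because both maps are continuous and agree at the rationals.\<close>

lemma ex_code_of_loop:
  fixes \<gamma> :: "real \<Rightarrow> 'a::complete_space"
  assumes \<gamma>: "continuous_on {0..1} \<gamma>" "\<gamma> 0 = x0" "\<gamma> 1 = x0"
  obtains c where "c \<in> loop_codes x0" "\<And>x. x \<in> {0..1} \<Longrightarrow> decode c x = \<gamma> x"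
proof -
  have "uniformly_continuous_on {0..1} \<gamma>" using \<gamma>(1) by (intro compact_uniformly_continuous) auto
  then have "\<exists>d>0. \<forall>x\<in>{0..1}. \<forall>y\<in>{0..1}. dist y x < d \<longrightarrow> dist (\<gamma> y) (\<gamma> x) < 1 / (real n + 1)" for n
    unfolding uniformly_continuous_on_def by simp
  then obtain d where d: "\<And>n. d n > 0"
    "\<And>n x y. x \<in> {0..1} \<Longrightarrow> y \<in> {0..1} \<Longrightarrow> dist y x < d n \<Longrightarrow> dist (\<gamma> y) (\<gamma> x) < 1 / (real n + 1)"
    by metis
  define c where "c = (\<lambda>q :: rat. \<gamma> (of_rat q), \<lambda>n :: nat. 1 / d n)"
  have c: "c \<in> loop_codes x0"
    unfolding loop_codes_def
  proof (intro CollectI conjI allI ballI impI)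
    fix n :: nat and q r :: rat
    assume qr: "q \<in> {0..1}" "r \<in> {0..1}" and "\<bar>of_rat q - of_rat r\<bar> * snd c n < 1"
    then have "dist (of_rat q) (of_rat r :: real) < d n" using d(1)[of n] by (simp add: c_def dist_real_def field_simps)
    then show "dist (fst c q) (fst c r) \<le> 1 / (real n + 1)"
      using d(2)[of "of_rat r" "of_rat q" n] qr by (simp add: c_def)
  qed (use \<gamma> in \<open>simp_all add: c_def\<close>)
  have "decode c x = \<gamma> x" if x: "x \<in> {0..1}" for x
  proof -
    obtain r :: "nat \<Rightarrow> rat" where r: "\<And>k. r k \<in> {0..1}" "(\<lambda>k. of_rat (r k)) \<longlonglongrightarrow> x"
      using rational_sequence_in_unit_interval[OF x] by metis
    have "(\<lambda>k. decode c (of_rat (r k))) \<longlonglongrightarrow> decode c x"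
      by (rule continuous_on_tendsto_compose[OF continuous_on_decode[OF c] r(2) x]) (use r(1) in simp)
    moreover have "(\<lambda>k. \<gamma> (of_rat (r k))) \<longlonglongrightarrow> \<gamma> x"
      by (rule continuous_on_tendsto_compose[OF \<gamma>(1) r(2) x]) (use r(1) in simp)
    ultimately show ?thesis
      using decode_of_rat[OF c] r(1) by (simp add: c_def LIMSEQ_unique)
  qed
  with c that show ?thesis by blast
qed

text \<open>The core of continuity for the compact-open topology. A neighbourhood of a code
  restricts finitely many coordinates only, but a bound on one modulus entry together with the
  values on a fine enough grid controls the whole path uniformly.\<close>

lemma open_decode_into:
  fixes x0 :: "'a::complete_space"
  assumes "compact K" "K \<subseteq> {0..1}" "open U"
  shows "openin (top_of_set (loop_codes x0)) {c \<in> loop_codes x0. decode c ` K \<subseteq> U}"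
proof (subst openin_subopen, intro ballI)
  fix c0 assume "c0 \<in> {c \<in> loop_codes x0. decode c ` K \<subseteq> U}"
  then have c0: "c0 \<in> loop_codes x0" "decode c0 ` K \<subseteq> U" by auto
  have "compact (decode c0 ` K)"
    using continuous_on_decode[OF c0(1)] assms by (meson compact_continuous_image continuous_on_subset)
  then obtain e where e: "e > 0" "(\<Union>y\<in>decode c0 ` K. ball y e) \<subseteq> U"
    using compact_subset_open_imp_ball_epsilon_subset assms(3) c0(2) by metis
  \<comment> \<open>Two modulus errors and one grid error, each below \<open>e / 4\<close>, add up
    to less than \<open>e\<close>.\<close>
  obtain n where n: "1 / (real n + 1) < e / 4"
    using reals_Archimedean[of "e / 4"] e(1) by (auto simp: inverse_eq_divide add.commute)
  \<comment> \<open>A strict bound on the entry of \<open>c0\<close> is an open condition, so it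
    persists nearby. A grid of mesh \<open>1 / N\<close> with \<open>N\<close> above
    \<open>M\<close> then meets the premise of \<open>decode_modulus\<close> for all these
    codes.\<close>
  define M where "M = \<bar>snd c0 n\<bar> + 1"
  have M: "M > 0" "snd c0 n < M" by (auto simp: M_def)
  obtain N :: nat where N: "M < real N" using reals_Archimedean2 by blast
  then have N0: "N > 0" using M(1) by (cases N) auto
  define q :: "nat \<Rightarrow> rat" where "q i = of_nat i / of_nat N" for i
  have q: "of_rat (q i) = real i / real N" for i by (simp add: q_def of_rat_divide)
  have q01: "q i \<in> {0..1}" if "i \<le> N" for i using that N0 by (simp add: q_def)
  define T where "T = {c :: (rat \<Rightarrow> 'a) \<times> (nat \<Rightarrow> real). snd c n < M} \<inter>
    (\<Inter>i\<in>{..N}. {c. dist (fst c (q i)) (fst c0 (q i)) < e / 4})"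
  have "open {c :: (rat \<Rightarrow> 'a) \<times> (nat \<Rightarrow> real). snd c n < M}"
    by (intro open_Collect_less continuous_on_const
        continuous_on_product_then_coordinatewise[OF continuous_on_snd[OF continuous_on_id]])
  moreover have "open {c :: (rat \<Rightarrow> 'a) \<times> (nat \<Rightarrow> real). dist (fst c (q i)) (fst c0 (q i)) < e / 4}" for i
    by (intro open_Collect_less continuous_on_const continuous_on_dist
        continuous_on_product_then_coordinatewise[OF continuous_on_fst[OF continuous_on_id]])
  ultimately have "open T" unfolding T_def by (intro open_Int open_INT) auto
  moreover have "c0 \<in> T" using M e by (auto simp: T_def)
  moreover have "decode c ` K \<subseteq> U" if c: "c \<in> loop_codes x0" "c \<in> T" for c
  proof
    fix y assume "y \<in> decode c ` K"
    then obtain x where x: "x \<in> K" "y = decode c x" by blast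
    then have x01: "x \<in> {0..1}" using assms(2) by blast
    \<comment> \<open>The last grid point not exceeding \<open>x\<close> is
      \<open>i / N\<close>.\<close>
    define i where "i = nat \<lfloor>x * real N\<rfloor>"
    have i: "real i \<le> x * real N" "x * real N < real i + 1" using x01 by (auto simp: i_def)
    have "x * real N \<le> real N" using x01 by (simp add: mult_left_le_one_le)
    then have "i \<le> N" using i(1) by linarith
    have "\<bar>x - real i / real N\<bar> = (x * real N - real i) / real N"
      using i(1) N0 by (simp add: field_simps)
    also have "\<dots> \<le> 1 / real N" using i(2) N0 by (intro divide_right_mono) auto
    finally have close: "\<bar>x - of_rat (q i)\<bar> \<le> 1 / real N" by (simp add: q)
    have small: "\<bar>x - of_rat (q i)\<bar> * m < 1" if "m < M" for m
    proof -
      have "\<bar>x - of_rat (q i)\<bar> * m \<le> \<bar>x - of_rat (q i)\<bar> * M" using that by (intro mult_left_mono) auto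
      also have "\<dots> \<le> 1 / real N * M" using close M by (intro mult_right_mono) auto
      also have "\<dots> < 1" using N N0 by simp
      finally show ?thesis .
    qed
    have "dist (decode c x) (fst c (q i)) \<le> 1 / (real n + 1)"
      using c(2) by (intro decode_modulus[OF c(1) x01 q01] small \<open>i \<le> N\<close>) (simp add: T_def)
    moreover have "dist (decode c0 x) (fst c0 (q i)) \<le> 1 / (real n + 1)"
      by (intro decode_modulus[OF c0(1) x01 q01] small \<open>i \<le> N\<close> M)
    moreover have "dist (fst c (q i)) (fst c0 (q i)) < e / 4"
      using c(2) \<open>i \<le> N\<close> by (auto simp: T_def)
    moreover have "dist (decode c0 x) (decode c x) \<le>
        dist (decode c0 x) (fst c0 (q i)) + dist (fst c (q i)) (fst c0 (q i)) + dist (decode c x) (fst c (q i))"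
      using dist_triangle[of "decode c0 x" "decode c x" "fst c0 (q i)"]
        dist_triangle[of "fst c0 (q i)" "decode c x" "fst c (q i)"] by (simp add: dist_commute)
    ultimately have "decode c x \<in> ball (decode c0 x) e" using n e(1) unfolding mem_ball by linarith
    then show "y \<in> U" using e(2) x by blast
  qed
  ultimately show "\<exists>T. openin (top_of_set (loop_codes x0)) T \<and> c0 \<in> T \<and>
      T \<subseteq> {c \<in> loop_codes x0. decode c ` K \<subseteq> U}"
    using c0 by (intro exI[of _ "loop_codes x0 \<inter> T"]) (auto intro: openin_open_Int)
qed

text \<open>Lets Borel questions about loops be asked about codes. Continuity is checked on subbasic
  sets, where a compact set in the simplex is replaced by its projection to the time axis.\<close>

lemma singular_loops_continuous_image:
  fixes x0 :: "'a::complete_space"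
  defines "\<phi> \<equiv> simplex_of_path \<circ> decode"
  shows "continuous_map (top_of_set (loop_codes x0)) (simplices_topology {x0}) \<phi>"
    and "\<phi> ` loop_codes x0 = singular_1_simplices {x0}"
proof -
  have S: "\<phi> c \<in> singular_1_simplices {x0}" if c: "c \<in> loop_codes x0" for c
    using decode_of_rat[OF c, of 0] decode_of_rat[OF c, of 1] c continuous_on_decode[OF c]
    unfolding \<phi>_def by (auto intro!: simplex_of_path_in_singular_1_simplices simp: loop_codes_def)
  show "\<phi> ` loop_codes x0 = singular_1_simplices {x0}"
  proof (intro equalityI subsetI)
    fix \<sigma> assume "\<sigma> \<in> singular_1_simplices {x0}"
    then have \<sigma>: "continuous_on (standard_simplex 1) \<sigma>" "\<sigma> \<in> extensional (standard_simplex 1)"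
      "\<sigma> (segment_point 0) = x0" "\<sigma> (segment_point 1) = x0"
      by (auto simp: singular_1_simplices_iff)
    obtain c where c: "c \<in> loop_codes x0" "\<And>x. x \<in> {0..1} \<Longrightarrow> decode c x = (\<sigma> \<circ> segment_point) x"
      using ex_code_of_loop[OF continuous_on_path_of_simplex[OF \<sigma>(1)], of x0] \<sigma>(3,4) by (metis comp_apply)
    have "\<phi> c = simplex_of_path (\<sigma> \<circ> segment_point)"
      unfolding \<phi>_def comp_def simplex_of_path_def
      by (rule restrict_ext) (use c(2) in_standard_simplex_1D(1) in \<open>auto simp: comp_def\<close>)
    then have "\<phi> c = \<sigma>" using simplex_of_path_of_simplex[OF \<sigma>(2)] by simp
    then show "\<sigma> \<in> \<phi> ` loop_codes x0" using c(1) by blast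
  qed (use S in blast)
  let ?X = "subtopology (powertop_real UNIV) (standard_simplex 1)"
  have X: "?X = top_of_set (standard_simplex 1)" by (simp add: euclidean_product_topology)
  have cm: "continuous_map ?X euclidean \<sigma> \<and> \<sigma> \<in> extensional (topspace ?X)"
    if "\<sigma> \<in> singular_1_simplices {x0}" for \<sigma>
    using that unfolding singular_1_simplices_iff X by simp
  have "continuous_map (top_of_set (loop_codes x0)) (compact_open_topology ?X euclidean) \<phi>"
    unfolding compact_open_topology_def
  proof (rule continuous_on_generated_topo)
    fix W :: "((nat \<Rightarrow> real) \<Rightarrow> 'a) set"
    assume "W \<in> {{f. continuous_map ?X euclidean f \<and> f \<in> extensional (topspace ?X) \<and> f ` K \<subseteq> U} |K U.
        compactin ?X K \<and> openin euclidean U}"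
    then obtain K and U :: "'a set" where W: "W = {f. continuous_map ?X euclidean f \<and> f \<in> extensional (topspace ?X) \<and> f ` K \<subseteq> U}"
      and K: "compactin ?X K" and U: "open U" by auto
    have K': "compact K" "K \<subseteq> standard_simplex 1" using K unfolding X by (auto simp: compactin_subtopology)
    have "compact ((\<lambda>x. x 1) ` K)" using K'(1)
      by (intro compact_continuous_image continuous_on_product_then_coordinatewise[OF continuous_on_id])
    moreover have "(\<lambda>x. x 1) ` K \<subseteq> {0..1}" using K'(2) in_standard_simplex_1D(1) by blast
    ultimately have "openin (top_of_set (loop_codes x0)) {c \<in> loop_codes x0. decode c ` (\<lambda>x. x 1) ` K \<subseteq> U}"
      using U by (rule open_decode_into)
    moreover have "\<phi> c ` K = decode c ` (\<lambda>x. x 1) ` K" for c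
      unfolding image_image using K'(2) by (intro image_cong) (auto simp: \<phi>_def simplex_of_path_def)
    then have "\<phi> -` W \<inter> topspace (top_of_set (loop_codes x0)) =
        {c \<in> loop_codes x0. decode c ` (\<lambda>x. x 1) ` K \<subseteq> U}"
      using cm[OF S] unfolding W by auto
    ultimately show "openin (top_of_set (loop_codes x0)) (\<phi> -` W \<inter> topspace (top_of_set (loop_codes x0)))"
      by simp
  next
    show "\<phi> ` topspace (top_of_set (loop_codes x0)) \<subseteq> \<Union>{{f. continuous_map ?X euclidean f \<and>
        f \<in> extensional (topspace ?X) \<and> f ` K \<subseteq> U} |K U. compactin ?X K \<and> openin euclidean U}"
      unfolding topology_generated_by_topspace[symmetric] compact_open_topology_def[symmetric]
        topspace_compact_open_topology using cm S by auto
  qed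
  then show "continuous_map (top_of_set (loop_codes x0)) (simplices_topology {x0}) \<phi>"
    unfolding simplices_topology_def continuous_map_in_subtopology using S by auto
qed

section \<open>Borel sets of loops\<close>

lemma sets_borel_of: "sets (borel_of X) = sigma_sets (topspace X) {U. openin X U}"
  unfolding borel_of_def by (rule sets_measure_of) (auto dest: openin_subset)

text \<open>\<open>F\<close> is pulled back to codes. These form a closed subset of a countable
  product of Polish spaces, where the countability result for Polish spaces applies.\<close>

lemma countable_image_of_singular_loops:
  fixes x0 :: "'a::polish_space" and F :: "((nat \<Rightarrow> real) \<Rightarrow> 'a) \<Rightarrow> 'd"
  assumes F: "\<And>B. {\<sigma> \<in> singular_1_simplices {x0}. F \<sigma> \<in> B} \<in> sets (borel_of (simplices_topology {x0}))"
  shows "countable (F ` singular_1_simplices {x0})"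
proof -
  define Q where "Q = loop_codes x0"
  define \<phi> :: "(rat \<Rightarrow> 'a) \<times> (nat \<Rightarrow> real) \<Rightarrow> _" where "\<phi> = simplex_of_path \<circ> decode"
  have cont: "continuous_map (top_of_set Q) (simplices_topology {x0}) \<phi>"
    and im: "\<phi> ` Q = singular_1_simplices {x0}"
    unfolding Q_def \<phi>_def by (rule singular_loops_continuous_image)+
  have Q: "Q \<in> sets borel" unfolding Q_def by (intro borel_closed closed_loop_codes)
  have top: "topspace (simplices_topology {x0}) = singular_1_simplices {x0}"
    using space_borel_of_simplices_topology[of "{x0}"]
    by (simp add: borel_of_def space_measure_of_conv)
  have meas: "\<phi> \<in> restrict_space borel Q \<rightarrow>\<^sub>M borel_of (simplices_topology {x0})"
    unfolding borel_of_def
  proof (rule measurable_measure_of)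
    fix U assume "U \<in> {U. openin (simplices_topology {x0}) U}"
    then have "openin (top_of_set Q) {c \<in> topspace (top_of_set Q). \<phi> c \<in> U}"
      using cont unfolding continuous_map_def by blast
    then obtain T where T: "open T" "{c \<in> Q. \<phi> c \<in> U} = Q \<inter> T"
      by (auto simp: openin_open)
    have "\<phi> -` U \<inter> space (restrict_space borel Q) = {c \<in> Q. \<phi> c \<in> U}"
      by (auto simp: space_restrict_space)
    then show "\<phi> -` U \<inter> space (restrict_space borel Q) \<in> sets (restrict_space borel Q)"
      unfolding T(2) sets_restrict_space using borel_open[OF T(1)] by simp
  next
    show "\<phi> \<in> space (restrict_space borel Q) \<rightarrow> topspace (simplices_topology {x0})"
      using im top by (auto simp: space_restrict_space)
  qed (auto dest: openin_subset)
  \<comment> \<open>\<open>None\<close> extends the map from \<open>Q\<close> to the whole type; as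
    \<open>Q\<close> is Borel, all preimages remain Borel.\<close>
  define F' where "F' c = (if c \<in> Q then Some (F (\<phi> c)) else None)" for c
  have "F' -` B \<in> sets borel" for B
  proof -
    define A where "A = {\<sigma> \<in> singular_1_simplices {x0}. F \<sigma> \<in> Some -` B}"
    have "\<phi> -` A \<inter> Q \<in> sets borel"
      using measurable_sets[OF meas F[of "Some -` B"]] Q
      by (simp add: A_def sets_restrict_space_iff space_restrict_space)
    moreover have "F' -` B = \<phi> -` A \<inter> Q \<union> (if None \<in> B then - Q else {})"
      using im by (auto simp: F'_def A_def split: if_splits)
    ultimately show ?thesis using Q by (simp add: borel_comp)
  qed
  then have "countable (range F')" by (rule countable_range_if_all_preimages_borel)
  moreover have "Some ` F ` singular_1_simplices {x0} \<subseteq> range F'"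
    unfolding im[symmetric] by (auto simp: F'_def image_iff)
  ultimately have "countable (Some ` F ` singular_1_simplices {x0})" using countable_subset by blast
  then show ?thesis by (rule countable_image_inj_on) simp
qed

text \<open>A subbasic set of the compact-open topology, for a one-point compact set.\<close>

lemma openin_simplices_topology_eval:
  assumes "t \<in> {0..1}" "open U"
  shows "openin (simplices_topology A) {\<tau> \<in> singular_1_simplices A. \<tau> (segment_point t) \<in> U}"
proof -
  let ?X = "subtopology (powertop_real UNIV) (standard_simplex 1)"
  let ?W = "{f. continuous_map ?X euclidean f \<and> f \<in> extensional (topspace ?X) \<and> f ` {segment_point t} \<subseteq> U}"
  have X: "?X = top_of_set (standard_simplex 1)" by (simp add: euclidean_product_topology)
  have K: "compactin ?X {segment_point t}"
    using segment_point_in_simplex[OF assms(1)] unfolding X by (simp add: compactin_subtopology)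
  have "openin (compact_open_topology ?X euclidean) ?W"
    unfolding compact_open_topology_def
  proof (rule topology_generated_by_Basis, rule CollectI, intro exI conjI)
    show "?W = ?W" ..
  qed (use K assms(2) in simp_all)
  then have "openin (simplices_topology A) (singular_1_simplices A \<inter> ?W)"
    unfolding simplices_topology_def by (rule openin_subtopology_Int2)
  moreover have "singular_1_simplices A \<inter> ?W = {\<tau> \<in> singular_1_simplices A. \<tau> (segment_point t) \<in> U}"
  proof -
    have "continuous_map ?X euclidean \<tau> \<and> \<tau> \<in> extensional (topspace ?X)"
      if "\<tau> \<in> singular_1_simplices A" for \<tau>
      using that unfolding singular_1_simplices_iff X by simp
    then show ?thesis by auto
  qed
  ultimately show ?thesis by simp
qed

section \<open>Non-existence of Borel sections\<close>

theorem theorem5p7: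
  fixes p :: "'b::topological_space \<Rightarrow> 'a::polish_space"
    and x0 :: 'a and xt0 :: 'b
  assumes "generalized_universal_covering TYPE('b + real) p"
    and "semilocally_simply_connected_at x0"
    and "uncountable (deck_group p)"
    and "xt0 \<in> p -` {x0}"
  shows "\<nexists>s. borel_section p x0 xt0 s"
proof
  note cov = assms(1)
  assume "\<exists>s. borel_section p x0 xt0 s"
  then obtain s where s: "borel_section p x0 xt0 s" by blast
  define D where "D = (\<lambda>h. h xt0) ` deck_group p"
  have meas: "s \<in> borel_of (simplices_topology {x0}) \<rightarrow>\<^sub>M borel_of (simplices_topology D)"
    and sect: "\<And>\<sigma>. \<sigma> \<in> singular_1_simplices {x0} \<Longrightarrow> simplex_map 1 p (s \<sigma>) = \<sigma>"
    using s unfolding borel_section_def D_def by blast+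
  have sD: "s \<sigma> \<in> singular_1_simplices D" if "\<sigma> \<in> singular_1_simplices {x0}" for \<sigma>
    using measurable_space[OF meas] that unfolding space_borel_of_simplices_topology .
  have deck: "p (h x) = p x" if "h \<in> deck_group p" for h x
  proof -
    have "p \<circ> h = p" using that by (simp add: deck_group_def)
    then show ?thesis by (metis comp_apply)
  qed
  have deck_cont: "continuous_on A h" and deck_inj: "inj h" if h: "h \<in> deck_group p" for h A
  proof -
    obtain k where "homeomorphism UNIV UNIV h k" using h by (auto simp: deck_group_def)
    then show "continuous_on A h" "inj h"
      by (auto simp: homeomorphism_def intro: continuous_on_subset inj_on_inverseI[of UNIV k h])
  qed
  have pD: "p d = x0" if "d \<in> D" for d using that deck assms(4) by (auto simp: D_def)
  \<comment> \<open>Orbit points are isolated in the fibre, so for endpoints in \<open>D\<close> an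
    open condition can express equality.\<close>
  have "\<exists>W. open W \<and> W \<inter> p -` {x0} = {d}" if "d \<in> D" for d
    using fibre_discrete[OF cov assms(2) pD[OF that]] by metis
  then obtain W where W: "\<And>d. d \<in> D \<Longrightarrow> open (W d)" "\<And>d. d \<in> D \<Longrightarrow> W d \<inter> p -` {x0} = {d}"
    by metis
  have WD: "e \<in> W d \<longleftrightarrow> e = d" if "d \<in> D" "e \<in> D" for d e
    using W(2)[OF that(1)] pD[OF that(2)] by auto
  define F where "F \<sigma> = (s \<sigma> (segment_point 0), s \<sigma> (segment_point 1))" for \<sigma>
  have "{\<sigma> \<in> singular_1_simplices {x0}. F \<sigma> \<in> B} \<in> sets (borel_of (simplices_topology {x0}))" for B
  proof -
    \<comment> \<open>A union over any number of pairs remains open, which is why \<open>B\<close>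
      can be arbitrary.\<close>
    define N where "N = (\<Union>(a, b)\<in>B \<inter> D \<times> D.
      {\<tau> \<in> singular_1_simplices D. \<tau> (segment_point 0) \<in> W a} \<inter>
      {\<tau> \<in> singular_1_simplices D. \<tau> (segment_point 1) \<in> W b})"
    have "openin (simplices_topology D) N"
      unfolding N_def using W(1)
      by (intro openin_Union) (auto intro!: openin_Int openin_simplices_topology_eval)
    then have "N \<in> sets (borel_of (simplices_topology D))"
      unfolding sets_borel_of by (intro sigma_sets.Basic) simp
    then have "s -` N \<inter> space (borel_of (simplices_topology {x0})) \<in> sets (borel_of (simplices_topology {x0}))"
      by (rule measurable_sets[OF meas])
    moreover have "s \<sigma> \<in> N \<longleftrightarrow> F \<sigma> \<in> B" if "\<sigma> \<in> singular_1_simplices {x0}" for \<sigma>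
    proof -
      have ends: "s \<sigma> (segment_point 0) \<in> D" "s \<sigma> (segment_point 1) \<in> D"
        using sD[OF that] unfolding singular_1_simplices_iff by auto
      show ?thesis
        using sD[OF that] ends WD unfolding N_def F_def by auto
    qed
    then have "s -` N \<inter> space (borel_of (simplices_topology {x0})) = {\<sigma> \<in> singular_1_simplices {x0}. F \<sigma> \<in> B}"
      unfolding space_borel_of_simplices_topology by auto
    ultimately show ?thesis by simp
  qed
  then have F_countable: "countable (F ` singular_1_simplices {x0})"
    by (rule countable_image_of_singular_loops)
  have "\<exists>\<gamma>. path \<gamma> \<and> \<gamma> 0 = xt0 \<and> \<gamma> 1 = d" for d
    by (metis path_between[OF cov])
  then obtain \<gamma> where \<gamma>: "\<And>d. path (\<gamma> d)" "\<And>d. \<gamma> d 0 = xt0" "\<And>d. \<gamma> d 1 = d"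
    by metis
  define \<sigma> where "\<sigma> d = simplex_of_path (p \<circ> \<gamma> d)" for d
  have \<sigma>: "\<sigma> d \<in> singular_1_simplices {x0}" if "d \<in> D" for d
    unfolding \<sigma>_def
  proof (rule simplex_of_path_in_singular_1_simplices)
    show "continuous_on {0..1} (p \<circ> \<gamma> d)"
      using \<gamma>(1)[of d] continuous_covering[OF cov] unfolding path_def by (rule continuous_on_compose)
  qed (use \<gamma> pD[OF that] assms(4) in auto)
  \<comment> \<open>The simplex \<open>s (\<sigma> d)\<close> starts at some \<open>h xt0\<close> in
    the orbit. So does \<open>h \<circ> \<gamma> d\<close>, which lies over the same loop, and
    unique lifting identifies the other endpoints.\<close>
  have F\<sigma>: "\<exists>h\<in>deck_group p. F (\<sigma> d) = (h xt0, h d)" if d: "d \<in> D" for d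
  proof -
    have S: "s (\<sigma> d) \<in> singular_1_simplices D" using sD \<sigma> d by blast
    then obtain h where h: "h \<in> deck_group p" "s (\<sigma> d) (segment_point 0) = h xt0"
      unfolding singular_1_simplices_iff D_def by auto
    have "(s (\<sigma> d) \<circ> segment_point) 1 = (h \<circ> \<gamma> d) 1"
    proof (rule path_lifting_unique[OF cov, where y = 0])
      show "continuous_on {0..1} (s (\<sigma> d) \<circ> segment_point)"
        using S by (intro continuous_on_path_of_simplex) (simp only: singular_1_simplices_iff)
      show "continuous_on {0..1} (h \<circ> \<gamma> d)"
        using \<gamma>(1)[of d] deck_cont[OF h(1)] unfolding path_def by (rule continuous_on_compose)
      show "p ((s (\<sigma> d) \<circ> segment_point) t) = p ((h \<circ> \<gamma> d) t)" if t: "t \<in> {0..1}" for t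
      proof -
        have "p (s (\<sigma> d) (segment_point t)) = simplex_map 1 p (s (\<sigma> d)) (segment_point t)"
          using segment_point_in_simplex[OF t] unfolding simplex_map_def by simp
        also have "\<dots> = \<sigma> d (segment_point t)" using sect[OF \<sigma>[OF d]] by simp
        also have "\<dots> = p (\<gamma> d t)"
          using segment_point_in_simplex[OF t] unfolding \<sigma>_def simplex_of_path_def by simp
        finally show ?thesis using deck[OF h(1)] by simp
      qed
    qed (use h \<gamma> in auto)
    then show ?thesis using h \<gamma>(3)[of d] by (auto simp: F_def)
  qed
  \<comment> \<open>By freeness the first component determines \<open>h\<close>; the second then
    determines \<open>d\<close>, since \<open>h\<close> is injective.\<close>
  have "inj_on (F \<circ> \<sigma>) D"
  proof (rule inj_onI)
    fix d d' assume d: "d \<in> D" "d' \<in> D" and eq: "(F \<circ> \<sigma>) d = (F \<circ> \<sigma>) d'"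
    obtain h h' where h: "h \<in> deck_group p" "F (\<sigma> d) = (h xt0, h d)"
      and h': "h' \<in> deck_group p" "F (\<sigma> d') = (h' xt0, h' d')"
      using F\<sigma> d by meson
    have "h = h'" by (rule deck_group_eqI[OF cov h(1) h'(1), of xt0]) (use eq h h' in simp)
    then have "h d = h d'" using eq h h' by simp
    then show "d = d'" using deck_inj[OF h(1)] by (simp add: inj_eq)
  qed
  moreover have "countable ((F \<circ> \<sigma>) ` D)"
    by (rule countable_subset[OF _ F_countable]) (use \<sigma> in auto)
  ultimately have "countable D" by (rule countable_image_inj_on[rotated])
  \<comment> \<open>Freeness again: the orbit map is injective, so a countable orbit forces a
    countable deck group.\<close>
  moreover have "inj_on (\<lambda>h. h xt0) (deck_group p)"
    by (rule inj_onI) (rule deck_group_eqI[OF cov])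
  ultimately have "countable (deck_group p)" unfolding D_def by (rule countable_image_inj_on)
  then show False using assms(3) by blast
qed

end
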